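(* Let $f_a(\ddot q,\dot q,q,t)$ be given functions, and set $$r_{ab}=\frac{\partial f_a}{\partial q^b}-\frac{\partial f_b}{\partial q^a}+\frac12\frac{d}{dt}\left(\frac{\partial f_b}{\partial \dot q^a}-\frac{\partial f_a}{\partial \dot q^b}\right),\qquad s_{ab}=\frac12\left(\frac{\partial f_a}{\partial \dot q^b}+\frac{\partial f_b}{\partial \dot q^a}\right)-\frac{d}{dt}\left(\frac{\partial f_b}{\partial \ddot q^a}\right).$$ The necessary and sufficient conditions for the equations $f_a(\ddot q,\dot q,q,t)=0$ to be of Lagrangian form with dissipative forces of gradient type, that is, for there to exist first-order functions $\Lambda(\dot q,q,t)$ (a Lagrangian) and $D(\dot q,q,t)$ (a dissipation function) such that $$f_a=\frac{d}{dt}\left(\frac{\partial \Lambda}{\partial \dot q^a}\right)-\frac{\partial \Lambda}{\partial q^a}+\frac{\partial D}{\partial \dot q^a},$$ are that the functions $r_{ab}$ and $s_{ab}$ are of first order, that $$\frac{\partial f_a}{\partial \ddot q^b}=\frac{\partial f_b}{\partial \ddot q^a},$$ and that $$\frac{\partial r_{ab}}{\partial \dot q^c}=\frac{\partial s_{ac}}{\partial q^b}-\frac{\partial s_{bc}}{\partial q^a}.$$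
   Context: Here $q^a$ are generalized coordinates (collectively denoted $q$), $\dot q^a$ the corresponding generalized velocities, $\ddot q^a$ the accelerations, and so on; $q,\dot q,\ddot q,\dddot q,t$ are treated as independent (jet) coordinates. The indices $a,b,c$ range over the degrees of freedom, the displayed conditions are required for all values of the free indices, and repeated indices are summed. The total time derivative is $$\frac{d}{dt}=\frac{\partial}{\partial t}+\dot q^c\frac{\partial}{\partial q^c}+\ddot q^c\frac{\partial}{\partial \dot q^c}+\dddot q^c\frac{\partial}{\partial \ddot q^c}$$ when acting on functions of $(\ddot q,\dot q,q,t)$, so that $r_{ab}$ and $s_{ab}$ may a priori depend on $(\dddot q,\ddot q,\dot q,q,t)$. A function is of first order if it depends only on $(\dot q,q,t)$, i.e. is independent of $\ddot q$ and higher-order derivative coordinates. *)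

theory Defs
  imports "HOL-Analysis.Analysis"
begin

text \<open>
  Points of the jet spaces list the coordinates from the highest derivative downwards:
  \<open>(v, q, t)\<close>, \<open>(a, v, q, t)\<close> and \<open>(j, a, v, q, t)\<close>, where \<open>v\<close>, \<open>a\<close>, \<open>j\<close> are the first,
  second and third time derivatives of \<open>q\<close>. The finite type \<open>'n\<close> indexes the degrees of freedom.
\<close>

type_synonym 'n jet1 = "(real^'n) \<times> (real^'n) \<times> real"
type_synonym 'n jet2 = "(real^'n) \<times> 'n jet1"
type_synonym 'n jet3 = "(real^'n) \<times> 'n jet2"

text \<open>
  The partial derivative with respect to a coordinate is \<open>partial_deriv\<close> along the unit vector of
  that coordinate; e.g. on \<open>'n jet2\<close> the direction \<open>(0, axis b 1, 0, 0)\<close> is that of the \<open>b\<close>-th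
  velocity.
\<close>

definition partial_deriv :: "'a::real_normed_vector \<Rightarrow> ('a \<Rightarrow> real) \<Rightarrow> 'a \<Rightarrow> real" where
  "partial_deriv u g x = deriv (\<lambda>h. g (x + h *\<^sub>R u)) 0"

text \<open>Both notions are meant for open \<open>S\<close>.\<close>

primrec Ck_on :: "nat \<Rightarrow> 'a::euclidean_space set \<Rightarrow> ('a \<Rightarrow> real) \<Rightarrow> bool" where
  "Ck_on 0 S g \<longleftrightarrow> continuous_on S g"
| "Ck_on (Suc k) S g \<longleftrightarrow>
     (\<forall>x\<in>S. g differentiable (at x)) \<and> (\<forall>u\<in>Basis. Ck_on k S (partial_deriv u g))"

definition smooth_on :: "'a::euclidean_space set \<Rightarrow> ('a \<Rightarrow> real) \<Rightarrow> bool" where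
  "smooth_on S g \<longleftrightarrow> (\<forall>k. Ck_on k S g)"

definition total_deriv1 :: "('n::finite jet1 \<Rightarrow> real) \<Rightarrow> 'n jet2 \<Rightarrow> real" where
  "total_deriv1 g = (\<lambda>(a, v, q, t).
      partial_deriv (0, 0, 1) g (v, q, t)
    + (\<Sum>c\<in>UNIV. v $ c * partial_deriv (0, axis c 1, 0) g (v, q, t))
    + (\<Sum>c\<in>UNIV. a $ c * partial_deriv (axis c 1, 0, 0) g (v, q, t)))"

definition total_deriv2 :: "('n::finite jet2 \<Rightarrow> real) \<Rightarrow> 'n jet3 \<Rightarrow> real" where
  "total_deriv2 g = (\<lambda>(j, a, v, q, t).
      partial_deriv (0, 0, 0, 1) g (a, v, q, t)
    + (\<Sum>c\<in>UNIV. v $ c * partial_deriv (0, 0, axis c 1, 0) g (a, v, q, t))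
    + (\<Sum>c\<in>UNIV. a $ c * partial_deriv (0, axis c 1, 0, 0) g (a, v, q, t))
    + (\<Sum>c\<in>UNIV. j $ c * partial_deriv (axis c 1, 0, 0, 0) g (a, v, q, t)))"

definition r_fun :: "('n::finite \<Rightarrow> 'n jet2 \<Rightarrow> real) \<Rightarrow> 'n \<Rightarrow> 'n \<Rightarrow> 'n jet3 \<Rightarrow> real" where
  "r_fun f a b = (\<lambda>(j, x).
      partial_deriv (0, 0, axis b 1, 0) (f a) x - partial_deriv (0, 0, axis a 1, 0) (f b) x
    + 1/2 * total_deriv2
        (\<lambda>y. partial_deriv (0, axis a 1, 0, 0) (f b) y - partial_deriv (0, axis b 1, 0, 0) (f a) y)
        (j, x))"

definition s_fun :: "('n::finite \<Rightarrow> 'n jet2 \<Rightarrow> real) \<Rightarrow> 'n \<Rightarrow> 'n \<Rightarrow> 'n jet3 \<Rightarrow> real" where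
  "s_fun f a b = (\<lambda>(j, x).
      1/2 * (partial_deriv (0, axis b 1, 0, 0) (f a) x + partial_deriv (0, axis a 1, 0, 0) (f b) x)
    - total_deriv2 (\<lambda>y. partial_deriv (axis a 1, 0, 0, 0) (f b) y) (j, x))"

definition first_order_on ::
    "(real^'n::finite) set \<Rightarrow> 'n jet1 set \<Rightarrow> ('n jet3 \<Rightarrow> real) \<Rightarrow> bool" where
  "first_order_on A W g \<longleftrightarrow> (\<exists>\<rho>. \<forall>j. \<forall>a\<in>A. \<forall>w\<in>W. g (j, a, w) = \<rho> w)"

end

theory Submission
  imports Defs
begin

text \<open>
  The coefficient of the jerk in \<open>s\<^sub>a\<^sub>b\<close> must
  vanish, so \<open>f\<^sub>a = M\<^sub>a\<^sub>c a\<^sup>c + k\<^sub>a\<close> with \<open>M\<close>, \<open>k\<close> of first order. The coefficient of the acceleration in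
  \<open>s\<^sub>a\<^sub>b\<close> then makes the velocity derivatives of the symmetric \<open>M\<close> totally symmetric, so \<open>M\<close> is
  the velocity Hessian of some \<open>K\<close>, and \<open>f\<close> is the Euler-Lagrange expression of \<open>K\<close> plus a first-order
  \<open>g\<close>. For such \<open>f\<close> the functions \<open>r\<close> and \<open>s\<close> depend on \<open>g\<close> only. The velocity curl \<open>\<omega>\<close> of \<open>g\<close> does
  not depend on the velocity because \<open>r\<close> is of first order, and the last condition says that \<open>\<omega>\<close> is a
  closed two-form in \<open>q\<close>. Adding \<open>v\<^sup>c B\<^sub>c(q, t)\<close> to \<open>K\<close>, where \<open>\<omega>/2\<close> is the exterior derivative of \<open>B\<close>,
  removes the curl, and what remains of \<open>g\<close> is a velocity gradient.
\<close>

section \<open>Partial derivatives and smooth functions\<close>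

lemma partial_deriv_eq_has_derivative:
  assumes "(g has_derivative g') (at x)"
  shows "partial_deriv u g x = g' u"
proof -
  interpret bounded_linear g' using assms by (rule has_derivative_bounded_linear)
  have "((\<lambda>h. g (x + h *\<^sub>R u)) has_derivative (\<lambda>h. g' (h *\<^sub>R u))) (at 0)"
    by (rule has_derivative_compose[where f = "\<lambda>h. x + h *\<^sub>R u" and g = g])
      (use assms in \<open>auto intro!: derivative_eq_intros\<close>)
  then have "((\<lambda>h. g (x + h *\<^sub>R u)) has_real_derivative g' u) (at 0)"
    by (simp add: has_field_derivative_def scaleR mult_commute_abs)
  then show ?thesis
    unfolding partial_deriv_def by (rule DERIV_imp_deriv)
qed

lemma has_derivative_partial_deriv:
  assumes "g differentiable (at x)"
  shows "(g has_derivative (\<lambda>u. partial_deriv u g x)) (at x)"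
proof -
  obtain g' where g': "(g has_derivative g') (at x)"
    using assms by (auto simp: differentiable_def)
  then have "(\<lambda>u. partial_deriv u g x) = g'"
    by (auto simp: partial_deriv_eq_has_derivative)
  with g' show ?thesis by simp
qed

lemma has_derivative_partial_deriv_Basis:
  fixes g :: "'a::euclidean_space \<Rightarrow> real"
  assumes "g differentiable (at x)"
  shows "(g has_derivative (\<lambda>w. \<Sum>u\<in>Basis. (w \<bullet> u) * partial_deriv u g x)) (at x)"
proof -
  have d: "(g has_derivative (\<lambda>u. partial_deriv u g x)) (at x)"
    using assms by (rule has_derivative_partial_deriv)
  interpret bounded_linear "\<lambda>u. partial_deriv u g x"
    using d by (rule has_derivative_bounded_linear)
  have "partial_deriv w g x = (\<Sum>u\<in>Basis. (w \<bullet> u) * partial_deriv u g x)" for w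
    by (subst (1) euclidean_representation[of w, symmetric]) (simp add: sum scaleR)
  then show ?thesis by (intro has_derivative_eq_rhs[OF d] ext)
qed

lemma has_real_derivative_along_line:
  assumes "g differentiable (at (x + t *\<^sub>R u))"
  shows "((\<lambda>t. g (x + t *\<^sub>R u)) has_real_derivative partial_deriv u g (x + t *\<^sub>R u)) (at t)"
proof -
  have d: "(g has_derivative (\<lambda>w. partial_deriv w g (x + t *\<^sub>R u))) (at (x + t *\<^sub>R u))"
    using assms by (rule has_derivative_partial_deriv)
  interpret bounded_linear "\<lambda>w. partial_deriv w g (x + t *\<^sub>R u)"
    using d by (rule has_derivative_bounded_linear)
  have "((\<lambda>h. g (x + h *\<^sub>R u)) has_derivative (\<lambda>h. partial_deriv (h *\<^sub>R u) g (x + t *\<^sub>R u))) (at t)"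
    by (rule has_derivative_compose[where f = "\<lambda>h. x + h *\<^sub>R u" and g = g, OF _ d])
      (auto intro!: derivative_eq_intros)
  then show ?thesis
    by (simp add: has_field_derivative_def scaleR mult_commute_abs)
qed

lemma partial_deriv_cong_open:
  assumes "open S" "x \<in> S" "\<And>y. y \<in> S \<Longrightarrow> g y = h y"
  shows "partial_deriv u g x = partial_deriv u h x"
proof -
  have "((\<lambda>h. x + h *\<^sub>R u) \<longlongrightarrow> x + 0 *\<^sub>R u) (nhds 0)"
    by (intro tendsto_intros filterlim_ident)
  then have "\<forall>\<^sub>F h in nhds 0. x + h *\<^sub>R u \<in> S"
    by (rule topological_tendstoD) (use assms in auto)
  then have "\<forall>\<^sub>F r in nhds 0. g (x + r *\<^sub>R u) = h (x + r *\<^sub>R u)"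
    by eventually_elim (use assms in auto)
  then show ?thesis
    unfolding partial_deriv_def by (intro deriv_cong_ev) auto
qed

lemma partial_deriv_const [simp]: "partial_deriv u (\<lambda>x. c) x = 0"
  by (simp add: partial_deriv_def)

lemma partial_deriv_bounded_linear:
  assumes "bounded_linear g"
  shows "partial_deriv u g x = g u"
  by (rule partial_deriv_eq_has_derivative) (rule bounded_linear_imp_has_derivative[OF assms])

lemma partial_deriv_add:
  assumes "g differentiable (at x)" "h differentiable (at x)"
  shows "partial_deriv u (\<lambda>y. g y + h y) x = partial_deriv u g x + partial_deriv u h x"
  by (rule partial_deriv_eq_has_derivative)
    (auto intro!: derivative_eq_intros has_derivative_partial_deriv assms)

lemma partial_deriv_diff:
  assumes "g differentiable (at x)" "h differentiable (at x)"
  shows "partial_deriv u (\<lambda>y. g y - h y) x = partial_deriv u g x - partial_deriv u h x"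
  by (rule partial_deriv_eq_has_derivative)
    (auto intro!: derivative_eq_intros has_derivative_partial_deriv assms)

lemma partial_deriv_mult:
  assumes "g differentiable (at x)" "h differentiable (at x)"
  shows "partial_deriv u (\<lambda>y. g y * h y) x = g x * partial_deriv u h x + partial_deriv u g x * h x"
  by (rule partial_deriv_eq_has_derivative)
    (auto intro!: derivative_eq_intros has_derivative_partial_deriv assms)

lemma partial_deriv_sum:
  assumes "\<And>i. i \<in> I \<Longrightarrow> g i differentiable (at x)"
  shows "partial_deriv u (\<lambda>y. \<Sum>i\<in>I. g i y) x = (\<Sum>i\<in>I. partial_deriv u (g i) x)"
  by (rule partial_deriv_eq_has_derivative)
    (auto intro!: derivative_eq_intros has_derivative_partial_deriv assms)

section \<open>Closure properties of C^k and smooth functions\<close>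

lemma Ck_on_imp_continuous_on: "Ck_on k S g \<Longrightarrow> continuous_on S g"
  by (cases k) (auto intro: continuous_at_imp_continuous_on differentiable_imp_continuous_within)

lemma Ck_on_Suc_imp: "Ck_on (Suc k) S g \<Longrightarrow> Ck_on k S g"
proof (induction k arbitrary: g)
  case 0
  then show ?case using Ck_on_imp_continuous_on[OF 0] by simp
next
  case (Suc k)
  then show ?case by (metis Ck_on.simps(2))
qed

lemma differentiable_cong_open:
  assumes "open S" "x \<in> S" "\<And>y. y \<in> S \<Longrightarrow> g y = h y" "g differentiable (at x)"
  shows "h differentiable (at x)"
proof -
  obtain g' where "(g has_derivative g') (at x)"
    using assms(4) by (auto simp: differentiable_def)
  then have "(h has_derivative g') (at x)"
    by (rule has_derivative_transform_within_open[OF _ assms(1,2,3)])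
  then show ?thesis by (auto simp: differentiable_def)
qed

text \<open>The sum and product rules determine a partial derivative only at points of
  \<open>S\<close>, whereas \<open>Ck_on\<close> speaks of the whole function
  \<open>partial_deriv u g\<close>. Openness of \<open>S\<close> lets one such function be exchanged
  for another that agrees with it on \<open>S\<close>.\<close>

lemma Ck_on_cong:
  assumes "open S"
  shows "Ck_on k S g \<Longrightarrow> (\<And>y. y \<in> S \<Longrightarrow> g y = h y) \<Longrightarrow> Ck_on k S h"
proof (induction k arbitrary: g h)
  case 0
  then show ?case by (simp cong: continuous_on_cong)
next
  case (Suc k)
  have "h differentiable (at x)" if "x \<in> S" for x
    using differentiable_cong_open[OF assms that Suc.prems(2)] Suc.prems(1) that by simp
  moreover have "Ck_on k S (partial_deriv u h)" if "u \<in> Basis" for u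
  proof (rule Suc.IH)
    show "Ck_on k S (partial_deriv u g)" using Suc.prems that by simp
    show "partial_deriv u g y = partial_deriv u h y" if "y \<in> S" for y
      by (rule partial_deriv_cong_open[OF assms that Suc.prems(2)])
  qed
  ultimately show ?case by simp
qed

lemma Ck_on_const: "Ck_on k S (\<lambda>x. c)"
  by (induction k arbitrary: c) (auto simp: partial_deriv_def[abs_def])

lemma Ck_on_bounded_linear:
  assumes "bounded_linear g"
  shows "Ck_on k S g"
proof (cases k)
  case 0
  then show ?thesis using assms by (simp add: linear_continuous_on)
next
  case (Suc k)
  have "partial_deriv u g = (\<lambda>x. g u)" for u
    using assms by (auto simp: partial_deriv_bounded_linear)
  then show ?thesis
    using Suc assms by (auto simp: Ck_on_const intro: bounded_linear_imp_differentiable)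
qed

lemma Ck_on_add:
  assumes "open S"
  shows "Ck_on k S g \<Longrightarrow> Ck_on k S h \<Longrightarrow> Ck_on k S (\<lambda>x. g x + h x)"
proof (induction k arbitrary: g h)
  case 0
  then show ?case by (auto intro: continuous_intros)
next
  case (Suc k)
  have "Ck_on k S (partial_deriv u (\<lambda>x. g x + h x))" if "u \<in> Basis" for u
    by (rule Ck_on_cong[OF assms Suc.IH[of "partial_deriv u g" "partial_deriv u h"]])
      (use Suc.prems that in \<open>auto simp: partial_deriv_add\<close>)
  with Suc.prems show ?case by auto
qed

lemma Ck_on_mult:
  assumes "open S"
  shows "Ck_on k S g \<Longrightarrow> Ck_on k S h \<Longrightarrow> Ck_on k S (\<lambda>x. g x * h x)"
proof (induction k arbitrary: g h)
  case 0
  then show ?case by (auto intro: continuous_intros)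
next
  case (Suc k)
  have "Ck_on k S (partial_deriv u (\<lambda>x. g x * h x))" if "u \<in> Basis" for u
    by (rule Ck_on_cong[OF assms Ck_on_add[OF assms Suc.IH[of g "partial_deriv u h"]
            Suc.IH[of "partial_deriv u g" h]]])
      (use Suc.prems that in \<open>auto simp: partial_deriv_mult intro: Ck_on_Suc_imp\<close>)
  with Suc.prems show ?case by auto
qed

named_theorems smooth_intros

lemma smooth_on_const [smooth_intros]: "smooth_on S (\<lambda>x. c)"
  by (simp add: smooth_on_def Ck_on_const)

lemma smooth_on_bounded_linear: "bounded_linear g \<Longrightarrow> smooth_on S g"
  by (simp add: smooth_on_def Ck_on_bounded_linear)

lemma smooth_on_add [smooth_intros]:
  "open S \<Longrightarrow> smooth_on S g \<Longrightarrow> smooth_on S h \<Longrightarrow> smooth_on S (\<lambda>x. g x + h x)"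
  by (simp add: smooth_on_def Ck_on_add)

lemma smooth_on_mult [smooth_intros]:
  "open S \<Longrightarrow> smooth_on S g \<Longrightarrow> smooth_on S h \<Longrightarrow> smooth_on S (\<lambda>x. g x * h x)"
  by (simp add: smooth_on_def Ck_on_mult)

lemma smooth_on_diff [smooth_intros]:
  assumes "open S" "smooth_on S g" "smooth_on S h"
  shows "smooth_on S (\<lambda>x. g x - h x)"
  using smooth_on_add[OF assms(1,2) smooth_on_mult[OF assms(1) smooth_on_const assms(3), of "-1"]]
  by simp

lemma smooth_on_sum [smooth_intros]:
  assumes "open S" "\<And>i. i \<in> I \<Longrightarrow> smooth_on S (g i)"
  shows "smooth_on S (\<lambda>x. \<Sum>i\<in>I. g i x)"
  using assms(2)
  by (induction I rule: infinite_finite_induct) (auto intro!: smooth_intros assms(1))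

lemma smooth_on_partial_deriv [smooth_intros]:
  "u \<in> Basis \<Longrightarrow> smooth_on S g \<Longrightarrow> smooth_on S (partial_deriv u g)"
  by (metis Ck_on.simps(2) smooth_on_def)

lemma smooth_on_imp_differentiable: "smooth_on S g \<Longrightarrow> x \<in> S \<Longrightarrow> g differentiable (at x)"
  by (metis Ck_on.simps(2) smooth_on_def)

lemma smooth_on_imp_continuous_on: "smooth_on S g \<Longrightarrow> continuous_on S g"
  by (metis Ck_on.simps(1) smooth_on_def)

text \<open>The second difference over a square of side \<open>h\<close> is the increment of a first
  difference. The mean value theorem, applied once in direction \<open>u\<close> and once in
  direction \<open>w\<close>, turns it into a mixed derivative at an interior point.\<close>

lemma mixed_difference_mean_value:
  fixes g :: "'a::euclidean_space \<Rightarrow> real"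
  assumes g: "\<And>s t. 0 \<le> s \<Longrightarrow> s \<le> h \<Longrightarrow> 0 \<le> t \<Longrightarrow> t \<le> h \<Longrightarrow> g differentiable (at (x + s *\<^sub>R u + t *\<^sub>R w))"
    and g': "\<And>s t. 0 \<le> s \<Longrightarrow> s \<le> h \<Longrightarrow> 0 \<le> t \<Longrightarrow> t \<le> h \<Longrightarrow>
        partial_deriv u g differentiable (at (x + s *\<^sub>R u + t *\<^sub>R w))"
    and "h > 0"
  shows "\<exists>s t. 0 < s \<and> s < h \<and> 0 < t \<and> t < h \<and>
     g (x + h *\<^sub>R u + h *\<^sub>R w) - g (x + h *\<^sub>R u) - g (x + h *\<^sub>R w) + g x
      = h\<^sup>2 * partial_deriv w (partial_deriv u g) (x + s *\<^sub>R u + t *\<^sub>R w)"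
proof -
  let ?\<phi> = "\<lambda>s. g (x + h *\<^sub>R w + s *\<^sub>R u) - g (x + s *\<^sub>R u)"
  have d: "(?\<phi> has_real_derivative
      partial_deriv u g (x + h *\<^sub>R w + s *\<^sub>R u) - partial_deriv u g (x + s *\<^sub>R u)) (at s)"
    if "0 \<le> s" "s \<le> h" for s
    by (intro derivative_intros has_real_derivative_along_line)
      (use g[of s h] g[of s 0] that \<open>h > 0\<close> in \<open>auto simp: algebra_simps\<close>)
  obtain s where s: "0 < s" "s < h" "?\<phi> h - ?\<phi> 0
      = (h - 0) * (partial_deriv u g (x + h *\<^sub>R w + s *\<^sub>R u) - partial_deriv u g (x + s *\<^sub>R u))"
    using MVT2[OF \<open>h > 0\<close> d] by blast
  have d': "((\<lambda>t. partial_deriv u g (x + s *\<^sub>R u + t *\<^sub>R w)) has_real_derivative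
      partial_deriv w (partial_deriv u g) (x + s *\<^sub>R u + t *\<^sub>R w)) (at t)"
    if "0 \<le> t" "t \<le> h" for t
    by (intro has_real_derivative_along_line) (use g'[of s t] that s in auto)
  obtain t where t: "0 < t" "t < h"
    "partial_deriv u g (x + s *\<^sub>R u + h *\<^sub>R w) - partial_deriv u g (x + s *\<^sub>R u + 0 *\<^sub>R w)
      = (h - 0) * partial_deriv w (partial_deriv u g) (x + s *\<^sub>R u + t *\<^sub>R w)"
    using MVT2[OF \<open>h > 0\<close> d'] by blast
  have "g (x + h *\<^sub>R u + h *\<^sub>R w) - g (x + h *\<^sub>R u) - g (x + h *\<^sub>R w) + g x = ?\<phi> h - ?\<phi> 0"
    by (simp add: algebra_simps)
  also have "\<dots> = h * (h * partial_deriv w (partial_deriv u g) (x + s *\<^sub>R u + t *\<^sub>R w))"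
    using s(3) t(3) by (simp add: algebra_simps)
  finally show ?thesis
    using s t unfolding power2_eq_square mult.assoc by blast
qed

text \<open>Clairaut's theorem. The second difference is symmetric in \<open>u\<close> and
  \<open>w\<close>, so the two mixed derivatives agree at two possibly different points of an
  arbitrarily small square at \<open>x\<close>; continuity moves both points to
  \<open>x\<close>.\<close>

lemma partial_deriv_commute:
  fixes g :: "'a::euclidean_space \<Rightarrow> real"
  assumes "open S" "smooth_on S g" "x \<in> S" and u: "u \<in> Basis" and w: "w \<in> Basis"
  shows "partial_deriv u (partial_deriv w g) x = partial_deriv w (partial_deriv u g) x"
proof -
  let ?F = "partial_deriv w (partial_deriv u g)" and ?G = "partial_deriv u (partial_deriv w g)"
  have "continuous_on S ?F" "continuous_on S ?G"
    using assms by (auto intro!: smooth_intros smooth_on_imp_continuous_on)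
  then have "isCont ?F x" "isCont ?G x"
    using assms by (auto simp: continuous_on_eq_continuous_at)
  have "\<bar>?F x - ?G x\<bar> < e" if "e > 0" for e
  proof -
    obtain d1 where d1: "d1 > 0" "\<And>y. dist y x < d1 \<Longrightarrow> dist (?F y) (?F x) < e / 2"
      using \<open>isCont ?F x\<close> \<open>e > 0\<close> unfolding continuous_at_eps_delta by (metis half_gt_zero)
    obtain d2 where d2: "d2 > 0" "\<And>y. dist y x < d2 \<Longrightarrow> dist (?G y) (?G x) < e / 2"
      using \<open>isCont ?G x\<close> \<open>e > 0\<close> unfolding continuous_at_eps_delta by (metis half_gt_zero)
    obtain d3 where d3: "d3 > 0" "\<And>y. dist y x < d3 \<Longrightarrow> y \<in> S"
      using assms(1,3) unfolding open_dist by blast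
    \<comment> \<open>A third of the radius keeps the square inside the ball, since
      \<open>s + t\<close> is at most \<open>2 * h\<close>.\<close>
    define h where "h = min d1 (min d2 d3) / 3"
    have h: "h > 0" using d1 d2 d3 by (simp add: h_def)
    have near: "dist (x + s *\<^sub>R u + t *\<^sub>R w) x < min d1 (min d2 d3)"
      if "0 \<le> s" "s \<le> h" "0 \<le> t" "t \<le> h" for s t
    proof -
      have "dist (x + s *\<^sub>R u + t *\<^sub>R w) x = norm (s *\<^sub>R u + t *\<^sub>R w)"
        by (simp add: dist_norm algebra_simps)
      also have "\<dots> \<le> s + t"
        using norm_triangle_ineq[of "s *\<^sub>R u" "t *\<^sub>R w"] u w that by simp
      also have "\<dots> < min d1 (min d2 d3)"
        using that h by (simp add: h_def)
      finally show ?thesis .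
    qed
    have S: "x + s *\<^sub>R u + t *\<^sub>R w \<in> S" "x + t *\<^sub>R w + s *\<^sub>R u \<in> S"
      if "0 \<le> s" "s \<le> h" "0 \<le> t" "t \<le> h" for s t
      using near[OF that] d3 by (auto simp: algebra_simps)
    have diff: "g differentiable (at y)" "partial_deriv u g differentiable (at y)"
      "partial_deriv w g differentiable (at y)" if "y \<in> S" for y
      using that assms by (auto intro!: smooth_on_imp_differentiable smooth_intros)
    obtain s t where st: "0 < s" "s < h" "0 < t" "t < h"
      "g (x + h *\<^sub>R u + h *\<^sub>R w) - g (x + h *\<^sub>R u) - g (x + h *\<^sub>R w) + g x
        = h\<^sup>2 * ?F (x + s *\<^sub>R u + t *\<^sub>R w)"
      using mixed_difference_mean_value[of h g x u w] S diff h by auto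
    obtain s' t' where st': "0 < s'" "s' < h" "0 < t'" "t' < h"
      "g (x + h *\<^sub>R w + h *\<^sub>R u) - g (x + h *\<^sub>R w) - g (x + h *\<^sub>R u) + g x
        = h\<^sup>2 * ?G (x + s' *\<^sub>R w + t' *\<^sub>R u)"
      using mixed_difference_mean_value[of h g x w u] S diff h by auto
    have "h\<^sup>2 * ?F (x + s *\<^sub>R u + t *\<^sub>R w) = h\<^sup>2 * ?G (x + t' *\<^sub>R u + s' *\<^sub>R w)"
      using st(5) st'(5) by (simp add: algebra_simps)
    then have "?F (x + s *\<^sub>R u + t *\<^sub>R w) = ?G (x + t' *\<^sub>R u + s' *\<^sub>R w)"
      using h by simp
    moreover have "dist (?F (x + s *\<^sub>R u + t *\<^sub>R w)) (?F x) < e / 2"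
      using near[of s t] st by (intro d1) auto
    moreover have "dist (?G (x + t' *\<^sub>R u + s' *\<^sub>R w)) (?G x) < e / 2"
      using near[of t' s'] st' by (intro d2) auto
    ultimately show ?thesis
      unfolding dist_real_def by linarith
  qed
  \<comment> \<open>Taking \<open>e\<close> to be the difference itself would give a number smaller
    than itself.\<close>
  then have "\<not> \<bar>?F x - ?G x\<bar> > 0" by blast
  then show ?thesis by simp
qed

section \<open>Integrals along rays in a coordinate subspace\<close>

text \<open>The homotopy operator of the Poincare lemma. The argument of \<open>g\<close> is
  \<open>x\<close> at \<open>s = 1\<close>; at \<open>s = 0\<close> its coordinates in the range of
  \<open>R\<close> are those of \<open>x\<^sub>0\<close>, while the remaining coordinates stay fixed
  as parameters.\<close>

definition radial_integral ::
    "('a::euclidean_space \<Rightarrow> 'a) \<Rightarrow> 'a \<Rightarrow> nat \<Rightarrow> ('a \<Rightarrow> real) \<Rightarrow> 'a \<Rightarrow> real" where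
  "radial_integral R x\<^sub>0 k g x = integral {0..1} (\<lambda>s. s ^ k * g (x - (1 - s) *\<^sub>R R (x - x\<^sub>0)))"

text \<open>\<open>R\<close> is the projection onto the span of those unit vectors that it fixes.\<close>

locale radial =
  fixes S :: "'a::euclidean_space set" and R :: "'a \<Rightarrow> 'a" and x\<^sub>0 :: 'a
  assumes open_S: "open S" and convex_S: "convex S"
    and linear_R: "bounded_linear R"
    and R_inner: "\<And>w u. u \<in> Basis \<Longrightarrow> R w \<bullet> u = (if R u = u then w \<bullet> u else 0)"
    and ray_in: "\<And>x s. x \<in> S \<Longrightarrow> 0 \<le> s \<Longrightarrow> s \<le> 1 \<Longrightarrow> x - (1 - s) *\<^sub>R R (x - x\<^sub>0) \<in> S"
begin

text \<open>The chain rule produces a factor \<open>s\<close> exactly in the contracted directions,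
  so this is the amount by which differentiation along \<open>u\<close> raises the exponent
  \<open>k\<close>.\<close>

definition weight :: "'a \<Rightarrow> nat" where
  "weight u = (if R u = u then 1 else 0)"

lemma ray_derivative_inner: "u \<in> Basis \<Longrightarrow> (w - (1 - s) *\<^sub>R R w) \<bullet> u = s ^ weight u * (w \<bullet> u)"
  by (simp add: weight_def inner_diff_left R_inner algebra_simps)

lemma continuous_on_ray:
  assumes "continuous_on S g"
  shows "continuous_on (S \<times> {0..1}) (\<lambda>(x, s). g (x - (1 - s) *\<^sub>R R (x - x\<^sub>0)))"
  unfolding split_beta
  by (rule continuous_on_compose2[OF assms])
    (auto intro!: continuous_intros bounded_linear.continuous_on[OF linear_R] ray_in)

lemma continuous_on_ray_section:
  assumes "continuous_on S g" "x \<in> S"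
  shows "continuous_on {0..1} (\<lambda>s. g (x - (1 - s) *\<^sub>R R (x - x\<^sub>0)))"
  by (rule continuous_on_compose2[OF assms(1)])
    (auto intro!: continuous_intros ray_in assms(2))

lemma radial_integrable:
  assumes "continuous_on S g" "x \<in> S"
  shows "(\<lambda>s. s ^ k * g (x - (1 - s) *\<^sub>R R (x - x\<^sub>0))) integrable_on {0..1}"
  by (intro integrable_continuous_real continuous_intros continuous_on_ray_section assms)

text \<open>Differentiation under the integral sign; the inner derivative of the ray is diagonal in
  the basis and is absorbed into the power of \<open>s\<close> by
  \<open>ray_derivative_inner\<close>.\<close>

lemma has_derivative_radial_integral:
  assumes g: "\<And>x. x \<in> S \<Longrightarrow> g differentiable (at x)"
    and g': "\<And>u. u \<in> Basis \<Longrightarrow> continuous_on S (partial_deriv u g)"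
    and x: "x \<in> S"
  shows "(radial_integral R x\<^sub>0 k g has_derivative
     (\<lambda>w. \<Sum>u\<in>Basis. (w \<bullet> u) * radial_integral R x\<^sub>0 (k + weight u) (partial_deriv u g) x)) (at x)"
proof -
  define \<phi> where "\<phi> x s = x - (1 - s) *\<^sub>R R (x - x\<^sub>0)" for x s
  \<comment> \<open>The derivative of the integrand is packaged as a bounded linear function because
    the Leibniz rule integrates it as a single value.\<close>
  define G where "G x s = (\<Sum>u\<in>Basis. (s ^ (k + weight u) * partial_deriv u g (\<phi> x s)) *\<^sub>R blinfun_inner_left u)"
    for x and s :: real
  have cont: "continuous_on S g"
    using g by (intro continuous_at_imp_continuous_on ballI differentiable_imp_continuous_within)
  have d\<phi>: "((\<lambda>x. \<phi> x s) has_derivative (\<lambda>w. w - (1 - s) *\<^sub>R R w)) (at x)" for x s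
  proof -
    have "((\<lambda>x. R (x - x\<^sub>0)) has_derivative R) (at x)"
      by (rule bounded_linear.has_derivative[OF linear_R]) (auto intro!: derivative_eq_intros)
    then show ?thesis
      unfolding \<phi>_def by (auto intro!: derivative_eq_intros)
  qed
  have d: "((\<lambda>x. s ^ k * g (\<phi> x s)) has_derivative blinfun_apply (G x s)) (at x within S)"
    if "x \<in> S" "s \<in> cbox 0 1" for x s
  proof (rule has_derivative_at_withinI)
    have "\<phi> x s \<in> S" using that ray_in by (auto simp: \<phi>_def)
    then have "((\<lambda>x. g (\<phi> x s)) has_derivative
        (\<lambda>w. \<Sum>u\<in>Basis. ((w - (1 - s) *\<^sub>R R w) \<bullet> u) * partial_deriv u g (\<phi> x s))) (at x)"
      by (intro has_derivative_compose[OF d\<phi> has_derivative_partial_deriv_Basis] g)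
    then have "((\<lambda>x. s ^ k * g (\<phi> x s)) has_derivative
        (\<lambda>w. s ^ k * (\<Sum>u\<in>Basis. ((w - (1 - s) *\<^sub>R R w) \<bullet> u) * partial_deriv u g (\<phi> x s)))) (at x)"
      by (rule has_derivative_mult_right)
    then show "((\<lambda>x. s ^ k * g (\<phi> x s)) has_derivative blinfun_apply (G x s)) (at x)"
      by (rule has_derivative_eq_rhs)
        (auto simp: G_def blinfun.sum_left blinfun.scaleR_left sum_distrib_left power_add
          ray_derivative_inner mult_ac intro!: ext sum.cong)
  qed
  have contG: "continuous_on (S \<times> cbox 0 1) (\<lambda>(x, s). G x s)"
  proof -
    have "continuous_on (S \<times> cbox 0 1) (\<lambda>p. partial_deriv u g (\<phi> (fst p) (snd p)))" if "u \<in> Basis" for u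
      using continuous_on_ray[OF g'[OF that]] by (simp add: split_beta \<phi>_def)
    then show ?thesis
      unfolding G_def split_beta
      by (intro continuous_on_sum continuous_on_scaleR continuous_on_mult continuous_on_power
          continuous_on_snd continuous_on_const continuous_on_id)
  qed
  have "((\<lambda>x. integral (cbox 0 1) (\<lambda>s. s ^ k * g (\<phi> x s))) has_derivative
      blinfun_apply (integral (cbox 0 1) (G x))) (at x within S)"
    by (rule leibniz_rule[OF d _ contG x convex_S])
      (use radial_integrable[OF cont] in \<open>auto simp: \<phi>_def\<close>)
  then have D: "(radial_integral R x\<^sub>0 k g has_derivative blinfun_apply (integral {0..1} (G x))) (at x)"
    unfolding at_within_open[OF x open_S] radial_integral_def[abs_def] \<phi>_def cbox_interval .
  have E: "blinfun_apply (integral {0..1} (G x)) w =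
      (\<Sum>u\<in>Basis. (w \<bullet> u) * radial_integral R x\<^sub>0 (k + weight u) (partial_deriv u g) x)" for w
  proof -
    have "continuous_on {0..1} (G x)"
      unfolding G_def \<phi>_def
      by (intro continuous_intros continuous_on_ray_section g' x)
    then have "blinfun_apply (integral {0..1} (G x)) w = integral {0..1} (\<lambda>s. blinfun_apply (G x s) w)"
      by (intro blinfun_apply_integral integrable_continuous_real)
    also have "\<dots> = integral {0..1} (\<lambda>s. \<Sum>u\<in>Basis. (w \<bullet> u) *
        (s ^ (k + weight u) * partial_deriv u g (x - (1 - s) *\<^sub>R R (x - x\<^sub>0))))"
      by (simp add: G_def blinfun.sum_left blinfun.scaleR_left \<phi>_def mult_ac)
    also have "\<dots> = (\<Sum>u\<in>Basis. integral {0..1} (\<lambda>s. (w \<bullet> u) *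
        (s ^ (k + weight u) * partial_deriv u g (x - (1 - s) *\<^sub>R R (x - x\<^sub>0)))))"
      by (intro integral_sum finite_Basis integrable_on_mult_right radial_integrable g' x)
    finally show ?thesis
      by (simp add: radial_integral_def)
  qed
  show ?thesis by (rule has_derivative_eq_rhs[OF D ext[OF E]])
qed

lemma partial_deriv_radial_integral:
  assumes "smooth_on S g" "x \<in> S" "u \<in> Basis"
  shows "partial_deriv u (radial_integral R x\<^sub>0 k g) x
    = radial_integral R x\<^sub>0 (k + weight u) (partial_deriv u g) x"
proof -
  have "partial_deriv u (radial_integral R x\<^sub>0 k g) x =
    (\<Sum>u'\<in>Basis. (u \<bullet> u') * radial_integral R x\<^sub>0 (k + weight u') (partial_deriv u' g) x)"
    by (intro partial_deriv_eq_has_derivative has_derivative_radial_integral)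
      (use assms in \<open>auto intro: smooth_on_imp_differentiable smooth_on_imp_continuous_on smooth_intros\<close>)
  also have "\<dots> = (\<Sum>u'\<in>Basis. if u' = u then
      radial_integral R x\<^sub>0 (k + weight u') (partial_deriv u' g) x else 0)"
    by (intro sum.cong) (use assms in \<open>auto simp: inner_Basis\<close>)
  also have "\<dots> = radial_integral R x\<^sub>0 (k + weight u) (partial_deriv u g) x"
    using assms by simp
  finally show ?thesis .
qed

text \<open>The functions \<open>radial_integral R x\<^sub>0 k g\<close> with \<open>g\<close> smooth and \<open>k\<close> arbitrary are closed under
  partial differentiation, whence the induction over all \<open>k\<close> and \<open>g\<close>.\<close>

lemma smooth_on_radial_integral:
  assumes "smooth_on S g"
  shows "smooth_on S (radial_integral R x\<^sub>0 k g)"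
proof -
  have diff: "radial_integral R x\<^sub>0 k g differentiable (at x)" if "smooth_on S g" "x \<in> S" for k g x
    unfolding differentiable_def
    by (rule exI, rule has_derivative_radial_integral)
      (use that in \<open>auto intro: smooth_on_imp_differentiable smooth_on_imp_continuous_on smooth_intros\<close>)
  have "Ck_on n S (radial_integral R x\<^sub>0 k g)" for n
    using assms
  proof (induction n arbitrary: k g)
    case 0
    then show ?case
      using diff by (auto intro!: continuous_at_imp_continuous_on differentiable_imp_continuous_within)
  next
    case (Suc n)
    have "Ck_on n S (partial_deriv u (radial_integral R x\<^sub>0 k g))" if "u \<in> Basis" for u
      by (rule Ck_on_cong[OF open_S Suc.IH[OF smooth_on_partial_deriv[OF that Suc.prems]]])
        (simp add: partial_deriv_radial_integral Suc.prems that)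
    with diff Suc.prems show ?case by simp
  qed
  then show ?thesis by (simp add: smooth_on_def)
qed

lemma radial_integral_cong:
  assumes "\<And>y. y \<in> S \<Longrightarrow> g y = h y" "x \<in> S"
  shows "radial_integral R x\<^sub>0 k g x = radial_integral R x\<^sub>0 k h x"
  unfolding radial_integral_def by (intro integral_cong) (use assms ray_in in auto)

lemma radial_integral_diff:
  assumes "continuous_on S g" "continuous_on S h" "x \<in> S"
  shows "radial_integral R x\<^sub>0 k (\<lambda>y. g y - h y) x
    = radial_integral R x\<^sub>0 k g x - radial_integral R x\<^sub>0 k h x"
  unfolding radial_integral_def
  by (subst integral_diff[symmetric]) (auto intro!: radial_integrable assms simp: right_diff_distrib)

text \<open>This is the fundamental theorem of calculus for \<open>s ^ Suc k * g\<close> along the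
  ray. The boundary value is \<open>g x\<close> at \<open>s = 1\<close> and zero at
  \<open>s = 0\<close>, as the exponent is positive; the two summands on the left come from the
  product rule.\<close>

lemma radial_integral_Euler:
  assumes g: "smooth_on S g" and x: "x \<in> S" and e: "\<And>c. c \<in> C \<Longrightarrow> e c \<in> Basis"
    and R: "R (x - x\<^sub>0) = (\<Sum>c\<in>C. \<alpha> c *\<^sub>R e c)" and "finite C"
  shows "real (Suc k) * radial_integral R x\<^sub>0 k g x
      + (\<Sum>c\<in>C. \<alpha> c * radial_integral R x\<^sub>0 (Suc k) (partial_deriv (e c) g) x) = g x"
proof -
  define \<phi> where "\<phi> s = x - (1 - s) *\<^sub>R R (x - x\<^sub>0)" for s
  have d: "((\<lambda>s. s ^ Suc k * g (\<phi> s)) has_vector_derivative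
      real (Suc k) * (s ^ k * g (\<phi> s)) + (\<Sum>c\<in>C. \<alpha> c * (s ^ Suc k * partial_deriv (e c) g (\<phi> s))))
      (at s within {0..1})" if s: "s \<in> {0..1}" for s
  proof -
    have "\<phi> s \<in> S" using ray_in x s by (auto simp: \<phi>_def)
    then have dg: "(g has_derivative (\<lambda>u. partial_deriv u g (\<phi> s))) (at (\<phi> s))"
      by (intro has_derivative_partial_deriv smooth_on_imp_differentiable[OF g])
    interpret bounded_linear "\<lambda>u. partial_deriv u g (\<phi> s)"
      using dg by (rule has_derivative_bounded_linear)
    have "(\<phi> has_derivative (\<lambda>h. h *\<^sub>R R (x - x\<^sub>0))) (at s)"
      unfolding \<phi>_def by (auto intro!: derivative_eq_intros)
    then have "((\<lambda>s. g (\<phi> s)) has_derivative (\<lambda>h. partial_deriv (h *\<^sub>R R (x - x\<^sub>0)) g (\<phi> s))) (at s)"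
      by (rule has_derivative_compose) (rule dg)
    then have "((\<lambda>s. g (\<phi> s)) has_real_derivative partial_deriv (R (x - x\<^sub>0)) g (\<phi> s)) (at s)"
      by (simp add: has_field_derivative_def scaleR mult_commute_abs)
    then have "((\<lambda>s. s ^ Suc k * g (\<phi> s)) has_real_derivative
       real (Suc k) * (s ^ k * g (\<phi> s)) + s ^ Suc k * partial_deriv (R (x - x\<^sub>0)) g (\<phi> s)) (at s)"
      by (rule DERIV_cong[OF DERIV_mult[OF DERIV_pow]]) (simp add: algebra_simps)
    moreover have "partial_deriv (R (x - x\<^sub>0)) g (\<phi> s) = (\<Sum>c\<in>C. \<alpha> c * partial_deriv (e c) g (\<phi> s))"
      by (simp add: R sum scaleR)
    ultimately have "((\<lambda>s. s ^ Suc k * g (\<phi> s)) has_real_derivative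
       real (Suc k) * (s ^ k * g (\<phi> s)) + (\<Sum>c\<in>C. \<alpha> c * (s ^ Suc k * partial_deriv (e c) g (\<phi> s)))) (at s)"
      by (simp add: sum_distrib_left mult_ac)
    then show ?thesis
      by (simp add: has_real_derivative_iff_has_vector_derivative has_vector_derivative_at_within)
  qed
  have int: "(\<lambda>s. s ^ j * h (\<phi> s)) integrable_on {0..1}" if "smooth_on S h" for j h
    unfolding \<phi>_def by (intro radial_integrable smooth_on_imp_continuous_on that x)
  have "((\<lambda>s. real (Suc k) * (s ^ k * g (\<phi> s)) + (\<Sum>c\<in>C. \<alpha> c * (s ^ Suc k * partial_deriv (e c) g (\<phi> s))))
      has_integral (1 ^ Suc k * g (\<phi> 1) - 0 ^ Suc k * g (\<phi> 0))) {0..1}"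
    by (rule fundamental_theorem_of_calculus[OF _ d]) auto
  then have "g x = integral {0..1} (\<lambda>s. real (Suc k) * (s ^ k * g (\<phi> s))
      + (\<Sum>c\<in>C. \<alpha> c * (s ^ Suc k * partial_deriv (e c) g (\<phi> s))))"
    by (simp add: integral_unique \<phi>_def)
  also have "\<dots> = integral {0..1} (\<lambda>s. real (Suc k) * (s ^ k * g (\<phi> s)))
      + integral {0..1} (\<lambda>s. \<Sum>c\<in>C. \<alpha> c * (s ^ Suc k * partial_deriv (e c) g (\<phi> s)))"
    by (intro integral_add integrable_on_mult_right integrable_sum int g smooth_intros e \<open>finite C\<close>)
  also have "integral {0..1} (\<lambda>s. \<Sum>c\<in>C. \<alpha> c * (s ^ Suc k * partial_deriv (e c) g (\<phi> s)))
     = (\<Sum>c\<in>C. integral {0..1} (\<lambda>s. \<alpha> c * (s ^ Suc k * partial_deriv (e c) g (\<phi> s))))"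
    by (intro integral_sum integrable_on_mult_right int g smooth_intros e \<open>finite C\<close>)
  finally show ?thesis
    by (simp add: radial_integral_def \<phi>_def del: power_Suc)
qed

end

section \<open>Calculus on the first jet space\<close>

abbreviation (input) pv :: "'n::finite \<Rightarrow> ('n jet1 \<Rightarrow> real) \<Rightarrow> 'n jet1 \<Rightarrow> real" where
  "pv c \<equiv> partial_deriv (axis c 1, 0, 0)"

abbreviation (input) pq :: "'n::finite \<Rightarrow> ('n jet1 \<Rightarrow> real) \<Rightarrow> 'n jet1 \<Rightarrow> real" where
  "pq c \<equiv> partial_deriv (0, axis c 1, 0)"

abbreviation (input) pt :: "('n::finite jet1 \<Rightarrow> real) \<Rightarrow> 'n jet1 \<Rightarrow> real" where
  "pt \<equiv> partial_deriv (0, 0, 1)"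

text \<open>The part of the total time derivative that does not involve the acceleration.\<close>

definition drift :: "('n::finite jet1 \<Rightarrow> real) \<Rightarrow> 'n jet1 \<Rightarrow> real" where
  "drift g w = pt g w + (\<Sum>c\<in>UNIV. fst w $ c * pq c g w)"

lemma total_deriv1_eq_drift:
  "total_deriv1 g (acc, w) = drift g w + (\<Sum>c\<in>UNIV. acc $ c * pv c g w)"
  by (cases w) (simp add: total_deriv1_def drift_def)

lemma Basis_jet1 [simp]:
  "(axis c 1, 0, 0) \<in> (Basis :: 'n::finite jet1 set)"
  "(0, axis c 1, 0) \<in> (Basis :: 'n::finite jet1 set)"
  "(0, 0, 1) \<in> (Basis :: 'n::finite jet1 set)"
  by (auto simp: Basis_prod_def zero_prod_def image_iff)

lemma Basis_jet2 [simp]: "(axis c 1, 0, 0, 0) \<in> (Basis :: 'n::finite jet2 set)"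
  by (auto simp: Basis_prod_def zero_prod_def image_iff)

lemma sum_axis_mult: "(\<Sum>c\<in>UNIV. axis b 1 $ c * F c) = (F b :: real)"
  by (simp add: axis_def if_distrib[of "\<lambda>x. x * _"] cong: if_cong)

lemma bounded_linear_vel: "bounded_linear (\<lambda>w::'n::finite jet1. fst w $ c)"
  by (rule bounded_linear_compose[OF bounded_linear_vec_nth bounded_linear_fst])

lemma bounded_linear_pos: "bounded_linear (\<lambda>w::'n::finite jet1. fst (snd w) $ c)"
  by (rule bounded_linear_compose[OF bounded_linear_vec_nth
        bounded_linear_compose[OF bounded_linear_fst bounded_linear_snd]])

lemma partial_deriv_vel [simp]: "partial_deriv u (\<lambda>w::'n::finite jet1. fst w $ c) w = fst u $ c"
  by (rule partial_deriv_bounded_linear[OF bounded_linear_vel])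

lemma partial_deriv_pos [simp]:
  "partial_deriv u (\<lambda>w::'n::finite jet1. fst (snd w) $ c) w = fst (snd u) $ c"
  by (rule partial_deriv_bounded_linear[OF bounded_linear_pos])

locale jet_domain =
  fixes W :: "'n::finite jet1 set"
  assumes open_W: "open W"
begin

lemmas smooth_simps [simp] =
  smooth_on_const smooth_on_partial_deriv smooth_on_add[OF open_W] smooth_on_diff[OF open_W]
  smooth_on_mult[OF open_W] smooth_on_sum[OF open_W]
  smooth_on_bounded_linear[OF bounded_linear_vel] smooth_on_bounded_linear[OF bounded_linear_pos]

lemma pd_add [simp]:
  "smooth_on W g \<Longrightarrow> smooth_on W h \<Longrightarrow> w \<in> W \<Longrightarrow>
    partial_deriv u (\<lambda>y. g y + h y) w = partial_deriv u g w + partial_deriv u h w"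
  by (simp add: partial_deriv_add smooth_on_imp_differentiable)

lemma pd_diff [simp]:
  "smooth_on W g \<Longrightarrow> smooth_on W h \<Longrightarrow> w \<in> W \<Longrightarrow>
    partial_deriv u (\<lambda>y. g y - h y) w = partial_deriv u g w - partial_deriv u h w"
  by (simp add: partial_deriv_diff smooth_on_imp_differentiable)

lemma pd_mult [simp]:
  "smooth_on W g \<Longrightarrow> smooth_on W h \<Longrightarrow> w \<in> W \<Longrightarrow>
    partial_deriv u (\<lambda>y. g y * h y) w = g w * partial_deriv u h w + partial_deriv u g w * h w"
  by (simp add: partial_deriv_mult smooth_on_imp_differentiable)

lemma smooth_on_divide_const [simp]: "smooth_on W g \<Longrightarrow> smooth_on W (\<lambda>y. g y / c)"
  unfolding divide_inverse by simp

lemma pd_divide_const [simp]: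
  "smooth_on W g \<Longrightarrow> w \<in> W \<Longrightarrow> partial_deriv u (\<lambda>y. g y / c) w = partial_deriv u g w / c"
  unfolding divide_inverse by simp

lemma pd_sum [simp]:
  "(\<And>i. i \<in> I \<Longrightarrow> smooth_on W (g i)) \<Longrightarrow> w \<in> W \<Longrightarrow>
    partial_deriv u (\<lambda>y. \<Sum>i\<in>I. g i y) w = (\<Sum>i\<in>I. partial_deriv u (g i) w)"
  by (rule partial_deriv_sum) (rule smooth_on_imp_differentiable)

lemmas pd_cong = partial_deriv_cong_open[OF open_W]
lemmas pd_commute = partial_deriv_commute[OF open_W]

lemma smooth_on_drift [simp]: "smooth_on W g \<Longrightarrow> smooth_on W (drift g)"
  by (simp add: drift_def[abs_def])

lemma drift_cong: "w \<in> W \<Longrightarrow> (\<And>y. y \<in> W \<Longrightarrow> g y = h y) \<Longrightarrow> drift g w = drift h w"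
  unfolding drift_def using pd_cong[of w g h] by simp

lemma drift_const [simp]: "drift (\<lambda>w. c) w = 0"
  by (simp add: drift_def)

lemma drift_add [simp]:
  "smooth_on W g \<Longrightarrow> smooth_on W h \<Longrightarrow> w \<in> W \<Longrightarrow> drift (\<lambda>y. g y + h y) w = drift g w + drift h w"
  by (simp add: drift_def algebra_simps sum.distrib)

lemma drift_diff [simp]:
  "smooth_on W g \<Longrightarrow> smooth_on W h \<Longrightarrow> w \<in> W \<Longrightarrow> drift (\<lambda>y. g y - h y) w = drift g w - drift h w"
  by (simp add: drift_def algebra_simps sum.distrib sum_subtractf)

lemma pq_drift:
  assumes "smooth_on W g" "w \<in> W"
  shows "pq b (drift g) w = drift (pq b g) w"
proof -
  have "pq b (drift g) w = pq b (pt g) w + (\<Sum>c\<in>UNIV. fst w $ c * pq b (pq c g) w)"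
    unfolding drift_def[abs_def] using assms by simp
  then show ?thesis
    unfolding drift_def using assms pd_commute[OF assms, of "(0, axis b 1, 0)"] by simp
qed

text \<open>Unlike in \<open>pq_drift\<close>, a coefficient of \<open>drift\<close> is
  differentiated here: the factor \<open>fst w $ c\<close> leaves the extra position
  derivative.\<close>

lemma pv_drift:
  assumes "smooth_on W g" "w \<in> W"
  shows "pv b (drift g) w = drift (pv b g) w + pq b g w"
proof -
  have "pv b (drift g) w = pv b (pt g) w
      + (\<Sum>c\<in>UNIV. fst w $ c * pv b (pq c g) w + axis b 1 $ c * pq c g w)"
    unfolding drift_def[abs_def] using assms by simp
  also have "(\<Sum>c\<in>UNIV. fst w $ c * pv b (pq c g) w + axis b 1 $ c * pq c g w)
      = (\<Sum>c\<in>UNIV. fst w $ c * pv b (pq c g) w) + pq b g w"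
    by (simp add: sum.distrib sum_axis_mult)
  finally show ?thesis
    unfolding drift_def using assms pd_commute[OF assms, of "(axis b 1, 0, 0)"] by simp
qed

end

section \<open>Functions affine in the acceleration\<close>

lemma partial_deriv_Pair_snd: "partial_deriv (0, u) g (x, y) = partial_deriv u (\<lambda>y. g (x, y)) y"
  by (simp add: partial_deriv_def)

lemma partial_deriv_Pair_fst: "partial_deriv (u, 0) g (x, y) = partial_deriv u (\<lambda>x. g (x, y)) x"
  by (simp add: partial_deriv_def)

locale jet2_domain = jet_domain W for W :: "'n::finite jet1 set" +
  fixes A :: "(real^'n) set"
  assumes open_A: "open A"
begin

lemma open_AW: "open (A \<times> W)"
  by (intro open_Times open_A open_W)

lemma partial_deriv_affine:
  assumes N: "\<And>c. smooth_on W (N c)" and l: "smooth_on W l"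
    and f: "\<forall>acc\<in>A. \<forall>w\<in>W. f (acc, w) = (\<Sum>c\<in>UNIV. acc $ c * N c w) + l w"
    and x: "acc \<in> A" "w \<in> W"
  shows "partial_deriv (0, u) f (acc, w) = (\<Sum>c\<in>UNIV. acc $ c * partial_deriv u (N c) w) + partial_deriv u l w"
    and "partial_deriv (axis c 1, 0, 0, 0) f (acc, w) = N c w"
proof -
  \<comment> \<open>Only values near the point count, so \<open>f\<close> may be replaced by its
    affine formula.\<close>
  have eq: "partial_deriv u' f (acc, w) = partial_deriv u' (\<lambda>(acc, w). (\<Sum>c\<in>UNIV. acc $ c * N c w) + l w) (acc, w)" for u'
    by (rule partial_deriv_cong_open[OF open_AW]) (use x f in auto)
  show "partial_deriv (0, u) f (acc, w) = (\<Sum>c\<in>UNIV. acc $ c * partial_deriv u (N c) w) + partial_deriv u l w"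
    unfolding eq partial_deriv_Pair_snd using N l x by simp
  have "((\<lambda>a. (\<Sum>c\<in>UNIV. a $ c * N c w) + l w) has_derivative (\<lambda>a. \<Sum>c\<in>UNIV. a $ c * N c w)) (at acc)"
    by (auto intro!: derivative_eq_intros bounded_linear_imp_has_derivative bounded_linear_vec_nth)
  from partial_deriv_eq_has_derivative[OF this]
  have "partial_deriv (axis c 1, 0) (\<lambda>(acc, w). (\<Sum>c\<in>UNIV. acc $ c * N c w) + l w) (acc, w) = N c w"
    unfolding partial_deriv_Pair_fst by (simp add: sum_axis_mult)
  then show "partial_deriv (axis c 1, 0, 0, 0) f (acc, w) = N c w"
    unfolding eq by (simp add: zero_prod_def)
qed

text \<open>Sorted by jerk and acceleration, the total derivative shows the coefficients that must
  vanish when \<open>r_fun\<close> or \<open>s_fun\<close> is of first order.\<close>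

lemma total_deriv2_affine:
  assumes N: "\<And>c. smooth_on W (N c)" and l: "smooth_on W l"
    and f: "\<forall>acc\<in>A. \<forall>w\<in>W. f (acc, w) = (\<Sum>c\<in>UNIV. acc $ c * N c w) + l w"
    and x: "acc \<in> A" "w \<in> W"
  shows "total_deriv2 f (j, acc, w) = (\<Sum>c\<in>UNIV. acc $ c * total_deriv1 (N c) (acc, w))
     + total_deriv1 l (acc, w) + (\<Sum>c\<in>UNIV. j $ c * N c w)"
proof -
  note pd = partial_deriv_affine[OF N l f x]
  have swap: "(\<Sum>c\<in>UNIV. \<beta> c * ((\<Sum>d\<in>UNIV. acc $ d * P c d) + p c))
      = (\<Sum>d\<in>UNIV. acc $ d * (\<Sum>c\<in>UNIV. \<beta> c * P c d)) + (\<Sum>c\<in>UNIV. \<beta> c * p c)"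
    for \<beta> p :: "'n \<Rightarrow> real" and P :: "'n \<Rightarrow> 'n \<Rightarrow> real"
  proof -
    have "(\<Sum>c\<in>UNIV. \<beta> c * (\<Sum>d\<in>UNIV. acc $ d * P c d)) = (\<Sum>d\<in>UNIV. acc $ d * (\<Sum>c\<in>UNIV. \<beta> c * P c d))"
      unfolding sum_distrib_left by (subst sum.swap) (simp add: mult_ac)
    then show ?thesis by (simp add: distrib_left sum.distrib)
  qed
  have "total_deriv2 f (j, acc, w) = partial_deriv (0, 0, 0, 1) f (acc, w)
    + (\<Sum>c\<in>UNIV. fst w $ c * partial_deriv (0, 0, axis c 1, 0) f (acc, w))
    + (\<Sum>c\<in>UNIV. acc $ c * partial_deriv (0, axis c 1, 0, 0) f (acc, w))
    + (\<Sum>c\<in>UNIV. j $ c * partial_deriv (axis c 1, 0, 0, 0) f (acc, w))"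
    by (cases w) (simp add: total_deriv2_def)
  then show ?thesis
    unfolding pd swap total_deriv1_eq_drift drift_def by (simp add: algebra_simps sum.distrib)
qed

end

section \<open>The functions r and s for affine and for Euler-Lagrange expressions\<close>

context jet2_domain
begin

lemma s_fun_affine:
  assumes M: "\<And>a c. smooth_on W (M a c)" and k: "\<And>a. smooth_on W (k a)"
    and f: "\<And>a. \<forall>acc\<in>A. \<forall>w\<in>W. f a (acc, w) = (\<Sum>c\<in>UNIV. acc $ c * M a c w) + k a w"
    and x: "acc \<in> A" "w \<in> W"
  shows "s_fun f a b (j, acc, w) =
    1/2 * ((\<Sum>c\<in>UNIV. acc $ c * (pv b (M a c) w + pv a (M b c) w)) + pv b (k a) w + pv a (k b) w)
    - total_deriv1 (M b a) (acc, w)"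
proof -
  note pd = partial_deriv_affine[OF M k f x]
  \<comment> \<open>On \<open>A \<times> W\<close> the function under the total derivative is
    \<open>M b a\<close>, which is affine with all acceleration coefficients zero; hence no jerk
    appears.\<close>
  have "total_deriv2 (\<lambda>y. partial_deriv (axis a 1, 0, 0, 0) (f b) y) (j, acc, w)
     = (\<Sum>c\<in>UNIV. acc $ c * total_deriv1 (\<lambda>w. 0) (acc, w))
     + total_deriv1 (M b a) (acc, w) + (\<Sum>c\<in>UNIV. j $ c * 0)"
    by (rule total_deriv2_affine) (auto simp: M x partial_deriv_affine(2)[OF M k f])
  then have "total_deriv2 (\<lambda>y. partial_deriv (axis a 1, 0, 0, 0) (f b) y) (j, acc, w)
     = total_deriv1 (M b a) (acc, w)"
    by (simp add: total_deriv1_eq_drift)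
  then show ?thesis
    by (simp add: s_fun_def pd distrib_left sum.distrib add_divide_distrib)
qed

lemma r_fun_affine:
  assumes M: "\<And>a c. smooth_on W (M a c)" and k: "\<And>a. smooth_on W (k a)"
    and f: "\<And>a. \<forall>acc\<in>A. \<forall>w\<in>W. f a (acc, w) = (\<Sum>c\<in>UNIV. acc $ c * M a c w) + k a w"
    and x: "acc \<in> A" "w \<in> W"
  shows "r_fun f a b (j, acc, w) =
    (\<Sum>c\<in>UNIV. acc $ c * (pq b (M a c) w - pq a (M b c) w)) + pq b (k a) w - pq a (k b) w
    + 1/2 * ((\<Sum>c\<in>UNIV. acc $ c * total_deriv1 (\<lambda>w. pv a (M b c) w - pv b (M a c) w) (acc, w))
      + total_deriv1 (\<lambda>w. pv a (k b) w - pv b (k a) w) (acc, w)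
      + (\<Sum>c\<in>UNIV. j $ c * (pv a (M b c) w - pv b (M a c) w)))"
proof -
  note pd = partial_deriv_affine[OF M k f x]
  have "total_deriv2
      (\<lambda>y. partial_deriv (0, axis a 1, 0, 0) (f b) y - partial_deriv (0, axis b 1, 0, 0) (f a) y) (j, acc, w)
    = (\<Sum>c\<in>UNIV. acc $ c * total_deriv1 (\<lambda>w. pv a (M b c) w - pv b (M a c) w) (acc, w))
      + total_deriv1 (\<lambda>w. pv a (k b) w - pv b (k a) w) (acc, w)
      + (\<Sum>c\<in>UNIV. j $ c * (pv a (M b c) w - pv b (M a c) w))"
    by (rule total_deriv2_affine)
      (auto simp: M k x partial_deriv_affine(1)[OF M k f] right_diff_distrib sum_subtractf)
  then show ?thesis
    by (simp add: r_fun_def pd right_diff_distrib sum_subtractf)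
qed

lemma EL_affine:
  assumes f: "\<And>a. \<forall>acc\<in>A. \<forall>w\<in>W.
      f a (acc, w) = total_deriv1 (pv a \<Lambda>) (acc, w) - pq a \<Lambda> w + g a w"
  shows "\<forall>acc\<in>A. \<forall>w\<in>W. f a (acc, w) = (\<Sum>c\<in>UNIV. acc $ c * pv c (pv a \<Lambda>) w)
      + (drift (pv a \<Lambda>) w - pq a \<Lambda> w + g a w)"
  using f by (simp add: total_deriv1_eq_drift)

text \<open>The Lagrangian drops out. Symmetrization cancels the mixed position-velocity derivatives
  of \<open>\<Lambda>\<close>, and what is left is the total derivative of its velocity Hessian,
  which \<open>s_fun\<close> subtracts.\<close>

lemma s_fun_EL:
  assumes L: "smooth_on W \<Lambda>" and g: "\<And>a. smooth_on W (g a)"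
    and f: "\<And>a. \<forall>acc\<in>A. \<forall>w\<in>W.
      f a (acc, w) = total_deriv1 (pv a \<Lambda>) (acc, w) - pq a \<Lambda> w + g a w"
    and x: "acc \<in> A" "w \<in> W"
  shows "s_fun f a b (j, acc, w) = 1/2 * (pv b (g a) w + pv a (g b) w)"
proof -
  have vv: "pv b (pv a \<Lambda>) y = pv a (pv b \<Lambda>) y" if "y \<in> W" for a b y
    using L that by (intro pd_commute) auto
  have vvv: "pv b (pv c (pv a \<Lambda>)) w = pv c (pv a (pv b \<Lambda>)) w" for a b c
  proof -
    have "pv b (pv c (pv a \<Lambda>)) w = pv c (pv b (pv a \<Lambda>)) w"
      using L x by (intro pd_commute) auto
    also have "\<dots> = pv c (pv a (pv b \<Lambda>)) w"
      by (rule pd_cong) (use x vv in auto)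
    finally show ?thesis .
  qed
  have vq: "pv b (pq a \<Lambda>) w = pq a (pv b \<Lambda>) w" for a b
    using L x by (intro pd_commute) auto
  have dvv: "drift (pv b (pv a \<Lambda>)) w = drift (pv a (pv b \<Lambda>)) w" for a b
    by (rule drift_cong) (use x vv in auto)
  have "s_fun f a b (j, acc, w) =
    1/2 * ((\<Sum>c\<in>UNIV. acc $ c * (pv b (pv c (pv a \<Lambda>)) w + pv a (pv c (pv b \<Lambda>)) w))
      + pv b (\<lambda>w. drift (pv a \<Lambda>) w - pq a \<Lambda> w + g a w) w
      + pv a (\<lambda>w. drift (pv b \<Lambda>) w - pq b \<Lambda> w + g b w) w)
    - total_deriv1 (pv a (pv b \<Lambda>)) (acc, w)"
    by (rule s_fun_affine[OF _ _ EL_affine[OF f]]) (use L g x in auto)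
  also have "(\<Sum>c\<in>UNIV. acc $ c * (pv b (pv c (pv a \<Lambda>)) w + pv a (pv c (pv b \<Lambda>)) w))
     = 2 * (\<Sum>c\<in>UNIV. acc $ c * pv c (pv a (pv b \<Lambda>)) w)"
    unfolding vvv[of b _ a] using vvv[of a _ b] pd_cong[of w "pv b (pv a \<Lambda>)" "pv a (pv b \<Lambda>)"] vv x
    by (simp add: sum_distrib_left mult.left_commute)
  also have "pv b (\<lambda>w. drift (pv a \<Lambda>) w - pq a \<Lambda> w + g a w) w
    = drift (pv a (pv b \<Lambda>)) w + pq b (pv a \<Lambda>) w - pq a (pv b \<Lambda>) w + pv b (g a) w"
    using L g x by (simp add: pv_drift vq dvv[of b a])
  also have "pv a (\<lambda>w. drift (pv b \<Lambda>) w - pq b \<Lambda> w + g b w) w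
    = drift (pv a (pv b \<Lambda>)) w + pq a (pv b \<Lambda>) w - pq b (pv a \<Lambda>) w + pv a (g b) w"
    using L g x by (simp add: pv_drift vq)
  finally show ?thesis
    by (simp add: total_deriv1_eq_drift algebra_simps)
qed

text \<open>The Lagrangian drops out. Half the total derivative of its velocity curl cancels the
  difference of the position derivatives, because \<open>pq\<close> commutes with
  \<open>drift\<close> and with \<open>pv\<close>.\<close>

lemma r_fun_EL:
  assumes L: "smooth_on W \<Lambda>" and g: "\<And>a. smooth_on W (g a)"
    and f: "\<And>a. \<forall>acc\<in>A. \<forall>w\<in>W.
      f a (acc, w) = total_deriv1 (pv a \<Lambda>) (acc, w) - pq a \<Lambda> w + g a w"
    and x: "acc \<in> A" "w \<in> W"
  shows "r_fun f a b (j, acc, w) = pq b (g a) w - pq a (g b) w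
    + 1/2 * total_deriv1 (\<lambda>w. pv a (g b) w - pv b (g a) w) (acc, w)"
proof -
  have vv: "pv b (pv a \<Lambda>) y = pv a (pv b \<Lambda>) y" if "y \<in> W" for a b y
    using L that by (intro pd_commute) auto
  have vvv: "pv b (pv c (pv a \<Lambda>)) y = pv a (pv c (pv b \<Lambda>)) y" if "y \<in> W" for a b c y
  proof -
    have "pv b (pv c (pv a \<Lambda>)) y = pv c (pv b (pv a \<Lambda>)) y"
      using L that by (intro pd_commute) auto
    also have "\<dots> = pv c (pv a (pv b \<Lambda>)) y"
      by (rule pd_cong) (use that vv in auto)
    also have "\<dots> = pv a (pv c (pv b \<Lambda>)) y"
      using L that by (intro pd_commute) auto
    finally show ?thesis .
  qed
  have vq: "pv b (pq a \<Lambda>) y = pq a (pv b \<Lambda>) y" if "y \<in> W" for a b y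
    using L that by (intro pd_commute) auto
  have qq: "pq b (pq a \<Lambda>) w = pq a (pq b \<Lambda>) w" for a b
    using L x by (intro pd_commute) auto
  have qvv: "pq b (pv c (pv a \<Lambda>)) w = pv c (pq b (pv a \<Lambda>)) w" for a b c
    using L x by (intro pd_commute) auto
  \<comment> \<open>The velocity curl of the Hessian vanishes on all of \<open>W\<close>, hence so
    do its derivatives.\<close>
  have zero: "total_deriv1 (\<lambda>w. pv a (pv c (pv b \<Lambda>)) w - pv b (pv c (pv a \<Lambda>)) w) (acc, w) = 0" for c
    unfolding total_deriv1_eq_drift
    using drift_cong[OF x(2), of "\<lambda>w. pv a (pv c (pv b \<Lambda>)) w - pv b (pv c (pv a \<Lambda>)) w" "\<lambda>w. 0"]
      pd_cong[OF x(2), of "\<lambda>w. pv a (pv c (pv b \<Lambda>)) w - pv b (pv c (pv a \<Lambda>)) w" "\<lambda>w. 0"] vvv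
    by simp
  let ?k = "\<lambda>a w. drift (pv a \<Lambda>) w - pq a \<Lambda> w + g a w"
  \<comment> \<open>One copy of the mixed terms comes from \<open>pv_drift\<close>, the other from
    the position derivative of \<open>\<Lambda>\<close>; the factor 1/2 in \<open>r_fun\<close>
    compensates for the 2.\<close>
  have curl: "pv a (?k b) y - pv b (?k a) y
      = 2 * (pq a (pv b \<Lambda>) y - pq b (pv a \<Lambda>) y) + (pv a (g b) y - pv b (g a) y)" if "y \<in> W" for y
    using L g that drift_cong[OF that, of "pv a (pv b \<Lambda>)" "pv b (pv a \<Lambda>)"] vv
    by (simp add: pv_drift vq)
  have "r_fun f a b (j, acc, w) =
    (\<Sum>c\<in>UNIV. acc $ c * (pq b (pv c (pv a \<Lambda>)) w - pq a (pv c (pv b \<Lambda>)) w)) + pq b (?k a) w - pq a (?k b) w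
    + 1/2 * ((\<Sum>c\<in>UNIV. acc $ c * total_deriv1 (\<lambda>w. pv a (pv c (pv b \<Lambda>)) w - pv b (pv c (pv a \<Lambda>)) w) (acc, w))
      + total_deriv1 (\<lambda>w. pv a (?k b) w - pv b (?k a) w) (acc, w)
      + (\<Sum>c\<in>UNIV. j $ c * (pv a (pv c (pv b \<Lambda>)) w - pv b (pv c (pv a \<Lambda>)) w)))"
    by (rule r_fun_affine[OF _ _ EL_affine[OF f]]) (use L g x in auto)
  also have "\<dots> = (\<Sum>c\<in>UNIV. acc $ c * (pq b (pv c (pv a \<Lambda>)) w - pq a (pv c (pv b \<Lambda>)) w))
      + pq b (?k a) w - pq a (?k b) w + 1/2 * total_deriv1 (\<lambda>w. pv a (?k b) w - pv b (?k a) w) (acc, w)"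
    using vvv[OF x(2)] zero by simp
  also have "total_deriv1 (\<lambda>w. pv a (?k b) w - pv b (?k a) w) (acc, w)
    = total_deriv1 (\<lambda>y. 2 * (pq a (pv b \<Lambda>) y - pq b (pv a \<Lambda>) y) + (pv a (g b) y - pv b (g a) y)) (acc, w)"
    unfolding total_deriv1_eq_drift using drift_cong[OF x(2) curl] pd_cong[OF x(2) curl] by simp
  also have "\<dots> = 2 * (drift (pq a (pv b \<Lambda>)) w - drift (pq b (pv a \<Lambda>)) w)
      + 2 * (\<Sum>c\<in>UNIV. acc $ c * (pv c (pq a (pv b \<Lambda>)) w - pv c (pq b (pv a \<Lambda>)) w))
      + total_deriv1 (\<lambda>y. pv a (g b) y - pv b (g a) y) (acc, w)"
    using L g x drift_add[of "\<lambda>y. pq a (pv b \<Lambda>) y - pq b (pv a \<Lambda>) y" "\<lambda>y. pq a (pv b \<Lambda>) y - pq b (pv a \<Lambda>) y"]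
    by (simp add: total_deriv1_eq_drift algebra_simps sum.distrib sum_subtractf sum_distrib_left)
  also have "pq b (?k a) w = drift (pq b (pv a \<Lambda>)) w - pq b (pq a \<Lambda>) w + pq b (g a) w"
    using L g x by (simp add: pq_drift)
  also have "pq a (?k b) w = drift (pq a (pv b \<Lambda>)) w - pq b (pq a \<Lambda>) w + pq a (g b) w"
    using L g x by (simp add: pq_drift qq)
  finally show ?thesis
    by (simp add: qvv algebra_simps sum_subtractf)
qed

end

section \<open>Poincare lemmas with parameters\<close>

lemma convex_towards_point:
  assumes "convex C" "c \<in> C" "x \<in> C" "0 \<le> s" "s \<le> (1::real)"
  shows "x - (1 - s) *\<^sub>R (x - c) \<in> C"
proof -
  have "x - (1 - s) *\<^sub>R (x - c) = s *\<^sub>R x + (1 - s) *\<^sub>R c"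
    by (simp add: algebra_simps)
  then show ?thesis
    using convexD[OF assms(1,3,2), of s "1 - s"] assms by simp
qed

lemma vec_eq_sum_axis: "(x::real^'n::finite) = (\<Sum>c\<in>UNIV. x $ c *\<^sub>R axis c 1)"
  using basis_expansion[of x] by (simp add: scalar_mult_eq_scaleR)

text \<open>In a product of convex sets, the velocities or the positions alone can be contracted to
  a base point without leaving the domain.\<close>

locale jet_box =
  fixes V Q :: "(real^'n::finite) set" and T :: "real set" and W :: "'n jet1 set"
  assumes opens: "open V" "open Q" "open T" and convexs: "convex V" "convex Q" "convex T"
    and W_eq: "W = V \<times> Q \<times> T"
begin

sublocale jet_domain W
  by standard (simp add: W_eq opens open_Times)

lemma convex_W: "convex W"
  by (simp add: W_eq convexs convex_Times)

text \<open>Poincare lemma for one-forms in the velocity, with position and time as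
  parameters.\<close>

lemma poincare_vel:
  assumes P: "\<And>a. smooth_on W (P a)" and v\<^sub>0: "v\<^sub>0 \<in> V"
    and curl: "\<And>a b w. w \<in> W \<Longrightarrow> pv b (P a) w = pv a (P b) w"
  shows "\<exists>\<Phi>. smooth_on W \<Phi> \<and> (\<forall>a. \<forall>w\<in>W. pv a \<Phi> w = P a w)"
proof -
  let ?R = "\<lambda>w::'n jet1. (fst w, 0::real^'n, 0::real)"
  interpret radial W ?R "(v\<^sub>0, 0, 0)"
  proof (rule radial.intro)
    show "bounded_linear ?R"
      by (intro bounded_linear_Pair bounded_linear_fst bounded_linear_zero)
    show "?R w \<bullet> u = (if ?R u = u then w \<bullet> u else 0)" if "u \<in> Basis" for w u :: "'n jet1"
      using that by (auto simp: Basis_prod_def zero_prod_def inner_prod_def split: if_splits)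
    show "x - (1 - s) *\<^sub>R ?R (x - (v\<^sub>0, 0, 0)) \<in> W" if "x \<in> W" "0 \<le> s" "s \<le> 1" for x s
      using that v\<^sub>0 convex_towards_point[OF convexs(1) v\<^sub>0] by (auto simp: W_eq)
  qed (rule open_W, rule convex_W)
  have weight: "weight (axis c 1, 0, 0) = 1" for c
    by (simp add: weight_def)
  let ?I = "radial_integral ?R (v\<^sub>0, 0, 0)"
  \<comment> \<open>The integral of the one-form along the segment from \<open>v\<^sub>0\<close> to
    the velocity of \<open>w\<close>.\<close>
  define \<Phi> where "\<Phi> w = (\<Sum>c\<in>UNIV. (fst w $ c - v\<^sub>0 $ c) * ?I 0 (P c) w)" for w
  have I: "smooth_on W (?I k (P c))" for k c
    by (rule smooth_on_radial_integral[OF P])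
  have "pv a \<Phi> w = P a w" if w: "w \<in> W" for a w
  proof -
    have "pv a \<Phi> w = (\<Sum>c\<in>UNIV. (fst w $ c - v\<^sub>0 $ c) * pv a (?I 0 (P c)) w)
        + (\<Sum>c\<in>UNIV. axis a 1 $ c * ?I 0 (P c) w)"
      unfolding \<Phi>_def using I w by (simp add: sum.distrib)
    also have "\<dots> = (\<Sum>c\<in>UNIV. (fst w $ c - v\<^sub>0 $ c) * ?I (Suc 0) (pv a (P c)) w) + ?I 0 (P a) w"
      using partial_deriv_radial_integral[OF P w] by (simp add: sum_axis_mult weight)
    \<comment> \<open>The curl condition exchanges the indices, so that only derivatives of
      \<open>P a\<close> remain and the Euler identity with \<open>k = 0\<close> applies.\<close>
    also have "(\<Sum>c\<in>UNIV. (fst w $ c - v\<^sub>0 $ c) * ?I (Suc 0) (pv a (P c)) w)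
        = (\<Sum>c\<in>UNIV. (fst w $ c - v\<^sub>0 $ c) * ?I (Suc 0) (pv c (P a)) w)"
      by (intro sum.cong refl arg_cong2[where f = "(*)"] radial_integral_cong curl w)
    also have "\<dots> + ?I 0 (P a) w = P a w"
    proof -
      have "?R (w - (v\<^sub>0, 0, 0)) = (\<Sum>c\<in>UNIV. (fst w $ c - v\<^sub>0 $ c) *\<^sub>R (axis c 1, 0, 0))"
        using vec_eq_sum_axis[of "fst w - v\<^sub>0"] by (simp add: prod_eq_iff fst_sum snd_sum)
      from radial_integral_Euler[OF P w _ this, of 0 a] show ?thesis by simp
    qed
    finally show ?thesis .
  qed
  moreover have "smooth_on W \<Phi>"
    unfolding \<Phi>_def using I by simp
  ultimately show ?thesis by blast
qed

text \<open>Poincare lemma for two-forms in the position. The potential inherits independence of the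
  velocity from the form, since the rays leave the velocity fixed.\<close>

lemma poincare_pos:
  assumes \<omega>: "\<And>a b. smooth_on W (\<omega> a b)" and q\<^sub>0: "q\<^sub>0 \<in> Q"
    and anti: "\<And>a b w. w \<in> W \<Longrightarrow> \<omega> a b w = - \<omega> b a w"
    and vel: "\<And>a b c w. w \<in> W \<Longrightarrow> pv c (\<omega> a b) w = 0"
    and closed: "\<And>a b c w. w \<in> W \<Longrightarrow> pq c (\<omega> a b) w + pq a (\<omega> b c) w + pq b (\<omega> c a) w = 0"
  shows "\<exists>B. (\<forall>a. smooth_on W (B a)) \<and> (\<forall>a c. \<forall>w\<in>W. pv c (B a) w = 0) \<and>
    (\<forall>a b. \<forall>w\<in>W. pq a (B b) w - pq b (B a) w = \<omega> a b w)"
proof -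
  let ?R = "\<lambda>w::'n jet1. (0::real^'n, fst (snd w), 0::real)"
  interpret radial W ?R "(0, q\<^sub>0, 0)"
  proof (rule radial.intro)
    show "bounded_linear ?R"
      by (intro bounded_linear_Pair bounded_linear_zero
          bounded_linear_compose[OF bounded_linear_fst bounded_linear_snd])
    show "?R w \<bullet> u = (if ?R u = u then w \<bullet> u else 0)" if "u \<in> Basis" for w u :: "'n jet1"
      using that by (auto simp: Basis_prod_def zero_prod_def inner_prod_def split: if_splits)
    show "x - (1 - s) *\<^sub>R ?R (x - (0, q\<^sub>0, 0)) \<in> W" if "x \<in> W" "0 \<le> s" "s \<le> 1" for x s
      using that q\<^sub>0 convex_towards_point[OF convexs(2) q\<^sub>0] by (auto simp: W_eq)
  qed (rule open_W, rule convex_W)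
  have weight: "weight (0, axis c 1, 0) = 1" "weight (axis c 1, 0, 0) = 0" for c
    by (simp_all add: weight_def axis_eq_0_iff)
  let ?I = "radial_integral ?R (0, q\<^sub>0, 0)"
  \<comment> \<open>The homotopy formula for a two-form: contraction with the ray direction, and the
    exponent 1 that this degree requires.\<close>
  define B where "B b w = (\<Sum>a\<in>UNIV. (fst (snd w) $ a - q\<^sub>0 $ a) * ?I 1 (\<omega> a b) w)" for b w
  have I: "smooth_on W (?I k (\<omega> a b))" for k a b
    by (rule smooth_on_radial_integral[OF \<omega>])
  have smooth: "smooth_on W (B b)" for b
    unfolding B_def[abs_def] using I by simp
  have I_0: "?I k (\<lambda>y. 0) w = 0" for k w
    by (simp add: radial_integral_def)
  have pvB: "pv c (B b) w = 0" if w: "w \<in> W" for b c w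
  proof -
    \<comment> \<open>Velocity directions have weight 0: the derivative goes directly to the
      integrand, where it vanishes by \<open>vel\<close>.\<close>
    have "pv c (?I 1 (\<omega> a b)) w = 0" for a
      using partial_deriv_radial_integral[OF \<omega> w]
        radial_integral_cong[of "pv c (\<omega> a b)" "\<lambda>y. 0" w 1] vel w by (simp add: weight I_0)
    then show ?thesis
      unfolding B_def[abs_def] using I w by simp
  qed
  have pqB: "pq c (B b) w = (\<Sum>a\<in>UNIV. (fst (snd w) $ a - q\<^sub>0 $ a) * ?I 2 (pq c (\<omega> a b)) w) + ?I 1 (\<omega> c b) w"
    if w: "w \<in> W" for b c w
  proof -
    have "pq c (B b) w = (\<Sum>a\<in>UNIV. (fst (snd w) $ a - q\<^sub>0 $ a) * pq c (?I 1 (\<omega> a b)) w)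
        + (\<Sum>a\<in>UNIV. axis c 1 $ a * ?I 1 (\<omega> a b) w)"
      unfolding B_def[abs_def] using I w by (simp add: sum.distrib)
    then show ?thesis
      using partial_deriv_radial_integral[OF \<omega> w] by (simp add: sum_axis_mult weight numeral_2_eq_2)
  qed
  have "pq c (B b) w - pq b (B c) w = \<omega> c b w" if w: "w \<in> W" for b c w
  proof -
    have pq_anti: "pq d (\<omega> a b) y = - pq d (\<omega> b a) y" if "y \<in> W" for a b d y
    proof -
      have "pq d (\<omega> a b) y = pq d (\<lambda>y. 0 - \<omega> b a y) y"
        by (rule pd_cong[OF that]) (simp add: anti[of _ a b])
      also have "\<dots> = pq d (\<lambda>y. 0) y - pq d (\<omega> b a) y"
        by (rule pd_diff) (use \<omega> that in auto)
      finally show ?thesis by simp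
    qed
    \<comment> \<open>Closedness and antisymmetry merge the two derivatives into a single one of the
      component \<open>\<omega> c b\<close>.\<close>
    have "?I 2 (pq c (\<omega> a b)) w - ?I 2 (pq b (\<omega> a c)) w = ?I 2 (pq a (\<omega> c b)) w" for a
    proof -
      have "?I 2 (pq c (\<omega> a b)) w - ?I 2 (pq b (\<omega> a c)) w = ?I 2 (\<lambda>y. pq c (\<omega> a b) y - pq b (\<omega> a c) y) w"
        by (rule radial_integral_diff[symmetric])
          (use \<omega> w in \<open>auto intro!: smooth_on_imp_continuous_on\<close>)
      also have "\<dots> = ?I 2 (pq a (\<omega> c b)) w"
      proof (rule radial_integral_cong[OF _ w])
        show "pq c (\<omega> a b) y - pq b (\<omega> a c) y = pq a (\<omega> c b) y" if "y \<in> W" for y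
          using closed[OF that, of c a b] pq_anti[OF that, of b a c] pq_anti[OF that, of a c b] by linarith
      qed
      finally show ?thesis .
    qed
    then have "(\<Sum>a\<in>UNIV. (fst (snd w) $ a - q\<^sub>0 $ a) * ?I 2 (pq c (\<omega> a b)) w)
      - (\<Sum>a\<in>UNIV. (fst (snd w) $ a - q\<^sub>0 $ a) * ?I 2 (pq b (\<omega> a c)) w)
      = (\<Sum>a\<in>UNIV. (fst (snd w) $ a - q\<^sub>0 $ a) * ?I 2 (pq a (\<omega> c b)) w)"
      by (simp flip: sum_subtractf right_diff_distrib)
    moreover have "?I 1 (\<omega> b c) w = - ?I 1 (\<omega> c b) w"
    proof -
      have "?I 1 (\<omega> b c) w = ?I 1 (\<lambda>y. 0 - \<omega> c b y) w"
        by (rule radial_integral_cong[OF _ w]) (simp add: anti[of _ b c])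
      also have "\<dots> = ?I 1 (\<lambda>y. 0) w - ?I 1 (\<omega> c b) w"
        by (rule radial_integral_diff) (use \<omega> w in \<open>auto intro!: smooth_on_imp_continuous_on\<close>)
      finally show ?thesis by (simp add: I_0)
    qed
    \<comment> \<open>The Euler identity with \<open>k = 1\<close>; its factor \<open>Suc 1\<close>
      matches the two equal terms left by antisymmetry.\<close>
    moreover have "2 * ?I 1 (\<omega> c b) w + (\<Sum>a\<in>UNIV. (fst (snd w) $ a - q\<^sub>0 $ a) * ?I 2 (pq a (\<omega> c b)) w)
        = \<omega> c b w"
    proof -
      have "?R (w - (0, q\<^sub>0, 0)) = (\<Sum>c\<in>UNIV. (fst (snd w) $ c - q\<^sub>0 $ c) *\<^sub>R (0, axis c 1, 0))"
        using vec_eq_sum_axis[of "fst (snd w) - q\<^sub>0"] by (simp add: prod_eq_iff fst_sum snd_sum)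
      from radial_integral_Euler[OF \<omega> w _ this, of 1 c b] show ?thesis
        by (simp add: numeral_2_eq_2)
    qed
    ultimately show ?thesis
      unfolding pqB[OF w] by linarith
  qed
  with smooth pvB show ?thesis by blast
qed

end

section \<open>Slices of functions on the second jet space\<close>

lemma differentiable_slice_snd:
  assumes "g differentiable (at (x, y))"
  shows "(\<lambda>y. g (x, y)) differentiable (at y)"
proof -
  obtain g' where "(g has_derivative g') (at (x, y))"
    using assms by (auto simp: differentiable_def)
  then have "((\<lambda>y. g (x, y)) has_derivative (\<lambda>h. g' (0, h))) (at y)"
    by (rule has_derivative_compose[rotated]) (auto intro!: derivative_eq_intros)
  then show ?thesis by (auto simp: differentiable_def)
qed

lemma differentiable_slice_fst:
  assumes "g differentiable (at (x, y))"
  shows "(\<lambda>x. g (x, y)) differentiable (at x)"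
proof -
  obtain g' where "(g has_derivative g') (at (x, y))"
    using assms by (auto simp: differentiable_def)
  then have "((\<lambda>x. g (x, y)) has_derivative (\<lambda>h. g' (h, 0))) (at x)"
    by (rule has_derivative_compose[rotated]) (auto intro!: derivative_eq_intros)
  then show ?thesis by (auto simp: differentiable_def)
qed

lemma Ck_on_slice_snd:
  "Ck_on k (A \<times> B) g \<Longrightarrow> x \<in> A \<Longrightarrow> Ck_on k B (\<lambda>y. g (x, y))"
proof (induction k arbitrary: g)
  case 0
  then show ?case
    by (auto intro!: continuous_on_compose2[of "A \<times> B" g] continuous_intros)
next
  case (Suc k)
  have "Ck_on k B (partial_deriv u (\<lambda>y. g (x, y)))" if "u \<in> Basis" for u
    using Suc that unfolding partial_deriv_Pair_snd[symmetric, abs_def]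
    by (auto simp: Basis_prod_def)
  with Suc.prems show ?case by (auto intro: differentiable_slice_snd)
qed

lemma smooth_on_slice_snd: "smooth_on (A \<times> B) g \<Longrightarrow> x \<in> A \<Longrightarrow> smooth_on B (\<lambda>y. g (x, y))"
  unfolding smooth_on_def using Ck_on_slice_snd by blast

lemma constant_on_convex_if_partials_zero:
  fixes h :: "real^'n::finite \<Rightarrow> real"
  assumes "convex A" "\<And>x. x \<in> A \<Longrightarrow> h differentiable (at x)"
    and "\<And>c x. x \<in> A \<Longrightarrow> partial_deriv (axis c 1) h x = 0" and "x \<in> A" "y \<in> A"
  shows "h x = h y"
proof (rule has_derivative_zero_unique[OF assms(1)])
  show "(h has_derivative (\<lambda>h. 0)) (at z within A)" if "z \<in> A" for z
  proof (rule has_derivative_at_withinI)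
    have "partial_deriv u h z = 0" if "u \<in> Basis" for u
      using that assms(3)[OF \<open>z \<in> A\<close>] by (auto simp: Basis_vec_def)
    then show "(h has_derivative (\<lambda>h. 0)) (at z)"
      using has_derivative_partial_deriv_Basis[OF assms(2)[OF that]] by simp
  qed
qed (use assms in auto)

lemma partial_deriv_linear_vec:
  "partial_deriv (axis c 1) (\<lambda>a::real^'n::finite. \<Sum>c\<in>UNIV. a $ c * \<alpha> c) x = \<alpha> c"
proof -
  have "((\<lambda>a. \<Sum>c\<in>UNIV. a $ c * \<alpha> c) has_derivative (\<lambda>a. \<Sum>c\<in>UNIV. a $ c * \<alpha> c)) (at x)"
    by (intro has_derivative_sum has_derivative_mult_left bounded_linear_imp_has_derivative bounded_linear_vec_nth)
  then show ?thesis
    by (simp add: partial_deriv_eq_has_derivative sum_axis_mult)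
qed

text \<open>Differentiation at \<open>a\<^sub>0\<close> along the axis \<open>c\<close> isolates the
  coefficient. This is how coefficients of the acceleration are read off from first-order
  functions.\<close>

lemma linear_constant_on_open_imp_zero:
  fixes A :: "(real^'n::finite) set"
  assumes "open A" "a\<^sub>0 \<in> A" "\<And>a. a \<in> A \<Longrightarrow> (\<Sum>c\<in>UNIV. a $ c * \<alpha> c) = \<beta>"
  shows "\<alpha> c = 0"
  using partial_deriv_cong_open[OF assms(1,2), of "\<lambda>a. \<Sum>c\<in>UNIV. a $ c * \<alpha> c" "\<lambda>a. \<beta>" "axis c 1"] assms(3)
  by (simp add: partial_deriv_linear_vec)

text \<open>Constancy on the convex set \<open>A\<close> is used twice: for the first partials, then
  for \<open>f\<close> minus the linear part that they define.\<close>

lemma affine_if_second_partials_zero: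
  fixes f :: "(real^'n::finite) \<times> 'b::euclidean_space \<Rightarrow> real"
  assumes A: "convex A" "a\<^sub>0 \<in> A" and f: "smooth_on (A \<times> B) f"
    and zero: "\<And>c d x. x \<in> A \<times> B \<Longrightarrow> partial_deriv (axis d 1, 0) (partial_deriv (axis c 1, 0) f) x = 0"
    and x: "a \<in> A" "y \<in> B"
  shows "f (a, y) = (\<Sum>c\<in>UNIV. a $ c * partial_deriv (axis c 1, 0) f (a\<^sub>0, y))
    + (f (a\<^sub>0, y) - (\<Sum>c\<in>UNIV. a\<^sub>0 $ c * partial_deriv (axis c 1, 0) f (a\<^sub>0, y)))"
proof -
  have B: "(axis c 1, 0) \<in> (Basis :: ((real^'n) \<times> 'b) set)" for c
    by (auto simp: Basis_prod_def)
  have M: "partial_deriv (axis c 1, 0) f (a', y) = partial_deriv (axis c 1, 0) f (a\<^sub>0, y)"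
    if "a' \<in> A" for c a'
  proof (rule constant_on_convex_if_partials_zero[OF A(1) _ _ that A(2)])
    show "(\<lambda>a. partial_deriv (axis c 1, 0) f (a, y)) differentiable (at x)" if "x \<in> A" for x
      by (intro differentiable_slice_fst smooth_on_imp_differentiable[of "A \<times> B"] smooth_intros B f)
        (use that \<open>y \<in> B\<close> in auto)
    show "partial_deriv (axis d 1) (\<lambda>a. partial_deriv (axis c 1, 0) f (a, y)) x = 0" if "x \<in> A" for d x
      using zero[of "(x, y)" d c] that \<open>y \<in> B\<close> by (simp add: partial_deriv_Pair_fst[of "axis d 1"])
  qed
  define m where "m c = partial_deriv (axis c 1, 0) f (a\<^sub>0, y)" for c
  have lin: "(\<lambda>a::real^'n. \<Sum>c\<in>UNIV. a $ c * m c) differentiable (at x)" for x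
    by (intro differentiable_sum ballI differentiable_mult differentiable_const finite
        bounded_linear_imp_differentiable[OF bounded_linear_vec_nth])
  have sl: "(\<lambda>a. f (a, y)) differentiable (at x)" if "x \<in> A" for x
    by (intro differentiable_slice_fst smooth_on_imp_differentiable[OF f]) (use that \<open>y \<in> B\<close> in auto)
  have "f (a, y) - (\<Sum>c\<in>UNIV. a $ c * m c) = f (a\<^sub>0, y) - (\<Sum>c\<in>UNIV. a\<^sub>0 $ c * m c)"
  proof (rule constant_on_convex_if_partials_zero[OF A(1) _ _ x(1) A(2)])
    show "(\<lambda>a. f (a, y) - (\<Sum>c\<in>UNIV. a $ c * m c)) differentiable (at x)" if "x \<in> A" for x
      by (intro differentiable_diff sl lin that)
    show "partial_deriv (axis d 1) (\<lambda>a. f (a, y) - (\<Sum>c\<in>UNIV. a $ c * m c)) x = 0" if "x \<in> A" for d x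
      using M[OF that, of d]
      by (simp add: partial_deriv_diff[OF sl[OF that] lin] partial_deriv_linear_vec
          partial_deriv_Pair_fst[symmetric] flip: m_def)
  qed
  then show ?thesis by (simp add: m_def)
qed

section \<open>Necessity and sufficiency\<close>

lemma partial_deriv_first_order:
  assumes "open W" "\<forall>j. \<forall>a\<in>A. \<forall>w\<in>W. g (j, a, w) = \<rho> w" "a \<in> A" "w \<in> W"
  shows "partial_deriv (0, 0, u) g (j, a, w) = partial_deriv u \<rho> w"
  unfolding partial_deriv_Pair_snd
  by (rule partial_deriv_cong_open[OF assms(1,4)]) (use assms in auto)

lemma first_order_onD:
  "first_order_on A W g \<Longrightarrow> a \<in> A \<Longrightarrow> a' \<in> A \<Longrightarrow> w \<in> W \<Longrightarrow> g (j, a, w) = g (j', a', w)"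
  by (auto simp: first_order_on_def)

text \<open>Comparing a unit jerk with zero jerk isolates one jerk coefficient.\<close>

lemma total_deriv2_jerk:
  "total_deriv2 g (axis c 1, x) = total_deriv2 g (0, x) + partial_deriv (axis c 1, 0, 0, 0) g x"
  by (cases x) (simp add: total_deriv2_def sum_axis_mult)

section \<open>Necessity of the conditions\<close>

context jet2_domain
begin

text \<open>With \<open>g a = pv a D\<close> the velocity curl vanishes. Then s is the velocity
  Hessian of \<open>D\<close>, r is a difference of its mixed derivatives, and the last condition is
  equality of third derivatives.\<close>

lemma lagrangian_with_dissipation_imp_conditions:
  assumes L: "smooth_on W \<Lambda>" and D: "smooth_on W D"
    and f: "\<And>a. \<forall>acc\<in>A. \<forall>w\<in>W.
      f a (acc, w) = total_deriv1 (pv a \<Lambda>) (acc, w) - pq a \<Lambda> w + pv a D w"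
  shows "first_order_on A W (r_fun f a b)"
    and "first_order_on A W (s_fun f a b)"
    and "x \<in> A \<times> W \<Longrightarrow>
      partial_deriv (axis b 1, 0, 0, 0) (f a) x = partial_deriv (axis a 1, 0, 0, 0) (f b) x"
    and "z \<in> UNIV \<times> A \<times> W \<Longrightarrow> partial_deriv (0, 0, axis c 1, 0, 0) (r_fun f a b) z
      = partial_deriv (0, 0, 0, axis b 1, 0) (s_fun f a c) z
        - partial_deriv (0, 0, 0, axis a 1, 0) (s_fun f b c) z"
proof -
  have pvD: "smooth_on W (pv a D)" for a using D by simp
  have vv: "pv a (pv b D) w = pv b (pv a D) w" if "w \<in> W" for a b w
    using D that by (intro pd_commute) auto
  have s: "\<forall>j. \<forall>acc\<in>A. \<forall>w\<in>W. s_fun f a b (j, acc, w) = pv b (pv a D) w" for a b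
    by (intro allI ballI) (simp add: s_fun_EL[OF L pvD f] vv[of _ a b])
  have r: "\<forall>j. \<forall>acc\<in>A. \<forall>w\<in>W. r_fun f a b (j, acc, w) = pq b (pv a D) w - pq a (pv b D) w" for a b
  proof (intro allI ballI)
    fix j acc w assume x: "acc \<in> A" "w \<in> W"
    have "total_deriv1 (\<lambda>w. pv a (pv b D) w - pv b (pv a D) w) (acc, w) = 0"
      unfolding total_deriv1_eq_drift
      using drift_cong[OF x(2), of "\<lambda>w. pv a (pv b D) w - pv b (pv a D) w" "\<lambda>w. 0"]
        pd_cong[OF x(2), of "\<lambda>w. pv a (pv b D) w - pv b (pv a D) w" "\<lambda>w. 0"] vv[of _ a b]
      by simp
    then show "r_fun f a b (j, acc, w) = pq b (pv a D) w - pq a (pv b D) w"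
      using r_fun_EL[OF L pvD f x] by simp
  qed
  show "first_order_on A W (r_fun f a b)"
    unfolding first_order_on_def by (rule exI) (rule r)
  show "first_order_on A W (s_fun f a b)"
    unfolding first_order_on_def by (rule exI) (rule s)
  show "partial_deriv (axis b 1, 0, 0, 0) (f a) x = partial_deriv (axis a 1, 0, 0, 0) (f b) x"
    if x_in: "x \<in> A \<times> W"
  proof -
    obtain acc w where x: "x = (acc, w)" "acc \<in> A" "w \<in> W" using x_in by blast
    have "partial_deriv (axis b 1, 0, 0, 0) (f a) x = pv b (pv a \<Lambda>) w" for a b
      unfolding x(1) by (rule partial_deriv_affine(2)[OF _ _ EL_affine[OF f]]) (use L D x in auto)
    then show ?thesis
      using pd_commute[OF L x(3)] by simp
  qed
  show "partial_deriv (0, 0, axis c 1, 0, 0) (r_fun f a b) z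
      = partial_deriv (0, 0, 0, axis b 1, 0) (s_fun f a c) z
        - partial_deriv (0, 0, 0, axis a 1, 0) (s_fun f b c) z" if z_in: "z \<in> UNIV \<times> A \<times> W"
  proof -
    obtain j acc w where z: "z = (j, acc, w)" "acc \<in> A" "w \<in> W" using z_in by blast
    have "pv c (pq b (pv a D)) w = pq b (pv c (pv a D)) w" for a b
      using D z by (intro pd_commute) auto
    then show ?thesis
      unfolding z(1) partial_deriv_first_order[OF open_W r z(2,3)]
        partial_deriv_first_order[OF open_W s z(2,3)]
      using D z by simp
  qed
qed

end

section \<open>Sufficiency: construction of the Lagrangian and the dissipation function\<close>

context jet_box
begin

text \<open>The point \<open>a\<^sub>0\<close> is where the acceleration is frozen to read off
  first-order coefficients; \<open>v\<^sub>0\<close> and \<open>q\<^sub>0\<close> are the centres of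
  the two Poincare lemmas. Time is a parameter throughout.\<close>

lemma conditions_imp_lagrangian_with_dissipation:
  assumes A: "open A" "convex A" "a\<^sub>0 \<in> A" and v\<^sub>0: "v\<^sub>0 \<in> V" and q\<^sub>0: "q\<^sub>0 \<in> Q"
    and f: "\<And>a. smooth_on (A \<times> W) (f a)"
    and r: "\<And>a b. first_order_on A W (r_fun f a b)"
    and s: "\<And>a b. first_order_on A W (s_fun f a b)"
    and sym: "\<And>a b x. x \<in> A \<times> W \<Longrightarrow>
      partial_deriv (axis b 1, 0, 0, 0) (f a) x = partial_deriv (axis a 1, 0, 0, 0) (f b) x"
    and compat: "\<And>a b c z. z \<in> UNIV \<times> A \<times> W \<Longrightarrow>
      partial_deriv (0, 0, axis c 1, 0, 0) (r_fun f a b) z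
        = partial_deriv (0, 0, 0, axis b 1, 0) (s_fun f a c) z
          - partial_deriv (0, 0, 0, axis a 1, 0) (s_fun f b c) z"
  shows "\<exists>\<Lambda> D. smooth_on W \<Lambda> \<and> smooth_on W D \<and> (\<forall>a. \<forall>acc\<in>A. \<forall>w\<in>W.
      f a (acc, w) = total_deriv1 (pv a \<Lambda>) (acc, w) - pq a \<Lambda> w + pv a D w)"
proof -
  interpret jet2_domain W A
    by unfold_locales (rule A)
  \<comment> \<open>The jerk coefficients of \<open>s_fun\<close> are, up to sign, the second
    acceleration derivatives of \<open>f\<close>.\<close>
  have second: "partial_deriv (axis c 1, 0) (partial_deriv (axis a 1, 0) (f b)) x = 0"
    if x: "x \<in> A \<times> W" for a b c x
  proof -
    obtain acc w where "x = (acc, w)" "acc \<in> A" "w \<in> W" using x by blast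
    then have "s_fun f a b (axis c 1, x) = s_fun f a b (0, x)"
      using first_order_onD[OF s] by simp
    then show ?thesis
      by (simp add: s_fun_def total_deriv2_jerk zero_prod_def)
  qed
  define M where "M a c w = partial_deriv (axis c 1, 0) (f a) (a\<^sub>0, w)" for a c w
  define k where "k a w = f a (a\<^sub>0, w) - (\<Sum>c\<in>UNIV. a\<^sub>0 $ c * M a c w)" for a w
  have "smooth_on W (\<lambda>w. partial_deriv (axis c 1, 0) (f a) (a\<^sub>0, w))" for a c
    by (rule smooth_on_slice_snd[OF smooth_on_partial_deriv[OF _ f] A(3)]) (simp add: zero_prod_def)
  then have M: "smooth_on W (M a c)" for a c
    by (simp add: M_def[abs_def])
  have k: "smooth_on W (k a)" for a
    unfolding k_def[abs_def] using M smooth_on_slice_snd[OF f A(3)] by simp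
  have f_aff: "\<forall>acc\<in>A. \<forall>w\<in>W. f a (acc, w) = (\<Sum>c\<in>UNIV. acc $ c * M a c w) + k a w" for a
    unfolding k_def M_def
    using affine_if_second_partials_zero[OF A(2,3) f second] by blast
  have M_sym: "M a b w = M b a w" if "w \<in> W" for a b w
    using sym[of "(a\<^sub>0, w)" b a] that A(3) by (simp add: M_def zero_prod_def)
  have M_sym': "partial_deriv u (M a b) w = partial_deriv u (M b a) w" if "w \<in> W" for u a b w
    by (rule pd_cong[OF that M_sym])

  \<comment> \<open>This is the coefficient of \<open>acc $ c\<close> in \<open>s_fun f a b\<close>,
    which must vanish since \<open>s_fun\<close> takes the same value at \<open>acc\<close> and at
    \<open>a\<^sub>0\<close>.\<close>
  have M_cyclic: "1/2 * (pv b (M a c) w + pv a (M b c) w) - pv c (M b a) w = 0" if w: "w \<in> W" for a b c w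
  proof (rule linear_constant_on_open_imp_zero[OF A(1,3), where c = c
        and \<alpha> = "\<lambda>c. 1/2 * (pv b (M a c) w + pv a (M b c) w) - pv c (M b a) w"])
    fix acc assume acc: "acc \<in> A"
    have "s_fun f a b (0, acc, w) =
        1/2 * ((\<Sum>c\<in>UNIV. acc $ c * (pv b (M a c) w + pv a (M b c) w)) + pv b (k a) w + pv a (k b) w)
        - total_deriv1 (M b a) (acc, w)"
      by (rule s_fun_affine[OF M k f_aff acc w])
    then show "(\<Sum>c\<in>UNIV. acc $ c * (1/2 * (pv b (M a c) w + pv a (M b c) w) - pv c (M b a) w))
      = s_fun f a b (0, a\<^sub>0, w) - 1/2 * (pv b (k a) w + pv a (k b) w) + drift (M b a) w"
      using first_order_onD[OF s[of a b] A(3) acc w, of 0 0]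
      by (simp add: total_deriv1_eq_drift algebra_simps sum.distrib sum_subtractf sum_divide_distrib
          add_divide_distrib)
  qed
  \<comment> \<open>The difference of two instances of \<open>M_cyclic\<close> is 3/2 times the
    difference of the two sides, once symmetry of \<open>M\<close> is used.\<close>
  have M_curl: "pv b (M a c) w = pv c (M a b) w" if w: "w \<in> W" for a b c w
    using M_cyclic[OF w, of b a c] M_cyclic[OF w, of c a b] M_sym'[OF w, of "(axis c 1, 0, 0)" a b]
      M_sym'[OF w, of "(axis b 1, 0, 0)" a c] M_sym'[OF w, of "(axis a 1, 0, 0)" b c] by argo
  have "\<exists>P. smooth_on W P \<and> (\<forall>c. \<forall>w\<in>W. pv c P w = M a c w)" for a
    by (rule poincare_vel[OF M v\<^sub>0 M_curl])
  then obtain P where P: "\<And>a. smooth_on W (P a)" and pvP: "\<And>a c w. w \<in> W \<Longrightarrow> pv c (P a) w = M a c w"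
    by metis
  \<comment> \<open>Each row of \<open>M\<close> is the velocity gradient of some
    \<open>P a\<close>; symmetry of \<open>M\<close> makes \<open>P\<close> curl-free in turn, so
    \<open>M\<close> is a Hessian.\<close>
  have "pv b (P a) w = pv a (P b) w" if "w \<in> W" for a b w
    unfolding pvP[OF that] by (rule M_sym[OF that])
  from poincare_vel[OF P v\<^sub>0 this]
  obtain K where K: "smooth_on W K" and pvK: "\<And>a w. w \<in> W \<Longrightarrow> pv a K w = P a w"
    by blast
  have pvvK: "pv c (pv a K) w = M a c w" if "w \<in> W" for a c w
    using pd_cong[OF that pvK, where u = "(axis c 1, 0, 0)"] pvP that by simp

  \<comment> \<open>The first-order remainder once the Euler-Lagrange expression of \<open>K\<close>
    is removed.\<close>
  define g where "g a w = k a w - (drift (pv a K) w - pq a K w)" for a w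
  have g: "smooth_on W (g a)" for a
    unfolding g_def[abs_def] using k K by simp
  have f_EL: "\<forall>acc\<in>A. \<forall>w\<in>W. f a (acc, w) = total_deriv1 (pv a K) (acc, w) - pq a K w + g a w" for a
    using f_aff pvvK by (simp add: g_def total_deriv1_eq_drift)
  define \<omega> where "\<omega> a b w = pv a (g b) w - pv b (g a) w" for a b w
  have \<omega>: "smooth_on W (\<omega> a b)" for a b
    unfolding \<omega>_def[abs_def] using g by simp
  have r_eq: "r_fun f a b (j, acc, w) = pq b (g a) w - pq a (g b) w + 1/2 * total_deriv1 (\<omega> a b) (acc, w)"
    if "acc \<in> A" "w \<in> W" for a b j acc w
    using r_fun_EL[OF K g f_EL that] by (simp add: \<omega>_def[abs_def])
  \<comment> \<open>Apart from the factor 1/2, this is the coefficient of \<open>acc $ c\<close> in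
    \<open>r_fun f a b\<close>.\<close>
  have pv\<omega>: "pv c (\<omega> a b) w = 0" if w: "w \<in> W" for a b c w
  proof (rule linear_constant_on_open_imp_zero[OF A(1,3), where c = c and \<alpha> = "\<lambda>c. pv c (\<omega> a b) w"])
    fix acc assume acc: "acc \<in> A"
    show "(\<Sum>c\<in>UNIV. acc $ c * pv c (\<omega> a b) w)
      = 2 * (r_fun f a b (0, a\<^sub>0, w) - pq b (g a) w + pq a (g b) w) - drift (\<omega> a b) w"
      using first_order_onD[OF r[of a b] A(3) acc w, of 0 0] r_eq[OF acc w, of a b 0]
      by (simp add: total_deriv1_eq_drift algebra_simps)
  qed
  have r_fo: "\<forall>j. \<forall>acc\<in>A. \<forall>w\<in>W.
      r_fun f a b (j, acc, w) = pq b (g a) w - pq a (g b) w + 1/2 * drift (\<omega> a b) w" for a b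
    using r_eq pv\<omega> by (simp add: total_deriv1_eq_drift)
  have s_fo: "\<forall>j. \<forall>acc\<in>A. \<forall>w\<in>W. s_fun f a b (j, acc, w) = 1/2 * (pv b (g a) w + pv a (g b) w)" for a b
    using s_fun_EL[OF K g f_EL] by simp
  have closed: "pq c (\<omega> a b) w + pq a (\<omega> b c) w + pq b (\<omega> c a) w = 0" if w: "w \<in> W" for a b c w
  proof -
    have drift0: "drift (pv c (\<omega> a b)) w = 0"
      using drift_cong[OF w pv\<omega>] by simp
    have com: "pv c (pq b (g a)) w = pq b (pv c (g a)) w" for a b c
      using g w by (intro pd_commute) auto
    have "(0, a\<^sub>0, w) \<in> UNIV \<times> A \<times> W" using w A by simp
    from compat[OF this, of c a b, unfolded partial_deriv_first_order[OF open_W r_fo A(3) w]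
        partial_deriv_first_order[OF open_W s_fo A(3) w]]
    \<comment> \<open>The velocity derivative of \<open>drift (\<omega> a b)\<close> is just
      \<open>pq c (\<omega> a b)\<close>, by \<open>drift0\<close>. Collected on one side, the terms
      form half the cyclic sum in the goal.\<close>
    have *: "pq b (pv c (g a)) w - pq a (pv c (g b)) w + 1/2 * pq c (\<omega> a b) w =
        1/2 * (pq b (pv c (g a)) w + pq b (pv a (g c)) w) - 1/2 * (pq a (pv c (g b)) w + pq a (pv b (g c)) w)"
      using g \<omega> w by (simp add: com pv_drift drift0)
    have **: "pq c (\<omega> a b) w = pq c (pv a (g b)) w - pq c (pv b (g a)) w" for a b c
      unfolding \<omega>_def[abs_def] using g w by simp
    show ?thesis
      using * unfolding ** by argo
  qed
  \<comment> \<open>Only half of \<open>\<omega>\<close> is needed, since a Lagrangian linear in the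
    velocity changes the velocity curl by twice the curl of its coefficients.\<close>
  have "\<exists>B. (\<forall>a. smooth_on W (B a)) \<and> (\<forall>a c. \<forall>w\<in>W. pv c (B a) w = 0) \<and>
    (\<forall>a b. \<forall>w\<in>W. pq a (B b) w - pq b (B a) w = 1/2 * \<omega> a b w)"
  proof (rule poincare_pos[OF _ q\<^sub>0])
    show "smooth_on W (\<lambda>w. 1/2 * \<omega> a b w)" for a b using \<omega> by simp
    show "1/2 * \<omega> a b w = - (1/2 * \<omega> b a w)" for a b w by (simp add: \<omega>_def field_simps)
    show "pv c (\<lambda>w. 1/2 * \<omega> a b w) w = 0" if "w \<in> W" for a b c w
      using \<omega> that pv\<omega> by simp
    show "pq c (\<lambda>w. 1/2 * \<omega> a b w) w + pq a (\<lambda>w. 1/2 * \<omega> b c w) w + pq b (\<lambda>w. 1/2 * \<omega> c a w) w = 0"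
      if "w \<in> W" for a b c w
      using closed[OF that, of c a b] \<omega> that by (simp add: field_simps)
  qed
  then obtain B where B: "\<And>a. smooth_on W (B a)" and pvB: "\<And>a c w. w \<in> W \<Longrightarrow> pv c (B a) w = 0"
    and curlB: "\<And>a b w. w \<in> W \<Longrightarrow> pq a (B b) w - pq b (B a) w = 1/2 * \<omega> a b w"
    by blast

  \<comment> \<open>A vector potential term. Its Euler-Lagrange expression contains no acceleration,
    because \<open>B\<close> does not depend on the velocity.\<close>
  define L where "L w = (\<Sum>c\<in>UNIV. fst w $ c * B c w)" for w
  have L: "smooth_on W L" unfolding L_def[abs_def] using B by simp
  have pvL: "pv a L w = B a w" if "w \<in> W" for a w
    unfolding L_def[abs_def] using B that pvB by (simp add: sum_axis_mult)
  have pqL: "pq a L w = (\<Sum>c\<in>UNIV. fst w $ c * pq a (B c) w)" if "w \<in> W" for a w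
    unfolding L_def[abs_def] using B that by simp
  define g' where "g' a w = g a w - (drift (B a) w - pq a L w)" for a w
  have g': "smooth_on W (g' a)" for a
    unfolding g'_def[abs_def] using g B L by simp
  have pvg': "pv b (g' a) w = pv b (g a) w - pq b (B a) w + pq a (B b) w" if w: "w \<in> W" for a b w
  proof -
    have "drift (pv b (B a)) w = 0"
      using drift_cong[OF w pvB] by simp
    moreover have "pv b (pq a L) w = pq a (B b) w"
    proof -
      have "pv b (pq a L) w = pq a (pv b L) w"
        using L w by (intro pd_commute) auto
      then show ?thesis using pd_cong[OF w pvL] by simp
    qed
    ultimately show ?thesis
      unfolding g'_def[abs_def] using g B L w by (simp add: pv_drift)
  qed
  \<comment> \<open>The curl of \<open>g'\<close> is \<open>\<omega>\<close> minus twice the curl of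
    \<open>B\<close>, hence zero; its velocity potential is the dissipation function.\<close>
  have "pv b (g' a) w = pv a (g' b) w" if w: "w \<in> W" for a b w
    using curlB[OF w, of a b] unfolding pvg'[OF w] \<omega>_def by simp
  from poincare_vel[OF g' v\<^sub>0 this]
  obtain D where D: "smooth_on W D" and pvD: "\<And>a w. w \<in> W \<Longrightarrow> pv a D w = g' a w"
    by blast
  define \<Lambda> where "\<Lambda> w = K w + L w" for w
  have "f a (acc, w) = total_deriv1 (pv a \<Lambda>) (acc, w) - pq a \<Lambda> w + pv a D w"
    if x: "acc \<in> A" "w \<in> W" for a acc w
  proof -
    have "pv a \<Lambda> y = pv a K y + B a y" if "y \<in> W" for y
      unfolding \<Lambda>_def[abs_def] using K L that pvL by simp
    then have "total_deriv1 (pv a \<Lambda>) (acc, w) = total_deriv1 (pv a K) (acc, w) + drift (B a) w"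
      unfolding total_deriv1_eq_drift
      using drift_cong[OF x(2), of "pv a \<Lambda>" "\<lambda>y. pv a K y + B a y"]
        pd_cong[OF x(2), of "pv a \<Lambda>" "\<lambda>y. pv a K y + B a y"] K B x pvB by simp
    moreover have "pq a \<Lambda> w = pq a K w + pq a L w"
      unfolding \<Lambda>_def[abs_def] using K L x by simp
    ultimately show ?thesis
      using f_EL x pvD by (simp add: g'_def)
  qed
  moreover have "smooth_on W \<Lambda>"
    unfolding \<Lambda>_def[abs_def] using K L by simp
  ultimately show ?thesis using D by blast
qed

end

text \<open>Convexity of \<open>A\<close> yields affine dependence on the acceleration over all of
  \<open>A\<close>; the convex box in the other coordinates makes the potentials exist on the whole
  domain.\<close>

theorem mainTheorem1:
  fixes f :: "'n::finite \<Rightarrow> 'n jet2 \<Rightarrow> real"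
    and A V Q :: "(real^'n) set" and T :: "real set"
  assumes "open A" "convex A" "open V" "convex V" "open Q" "convex Q" "open T" "convex T"
    and "\<And>a. smooth_on (A \<times> V \<times> Q \<times> T) (f a)"
  shows "(\<exists>\<Lambda> D :: 'n jet1 \<Rightarrow> real.
            smooth_on (V \<times> Q \<times> T) \<Lambda> \<and> smooth_on (V \<times> Q \<times> T) D \<and>
            (\<forall>a. \<forall>acc\<in>A. \<forall>w\<in>V \<times> Q \<times> T.
               f a (acc, w) = total_deriv1 (partial_deriv (axis a 1, 0, 0) \<Lambda>) (acc, w)
                 - partial_deriv (0, axis a 1, 0) \<Lambda> w + partial_deriv (axis a 1, 0, 0) D w))
     \<longleftrightarrow>
         (\<forall>a b. first_order_on A (V \<times> Q \<times> T) (r_fun f a b)) \<and>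
         (\<forall>a b. first_order_on A (V \<times> Q \<times> T) (s_fun f a b)) \<and>
         (\<forall>a b. \<forall>x\<in>A \<times> V \<times> Q \<times> T.
            partial_deriv (axis b 1, 0, 0, 0) (f a) x = partial_deriv (axis a 1, 0, 0, 0) (f b) x) \<and>
         (\<forall>a b c. \<forall>z\<in>UNIV \<times> A \<times> V \<times> Q \<times> T.
            partial_deriv (0, 0, axis c 1, 0, 0) (r_fun f a b) z
              = partial_deriv (0, 0, 0, axis b 1, 0) (s_fun f a c) z
                - partial_deriv (0, 0, 0, axis a 1, 0) (s_fun f b c) z)"
    (is "?EL \<longleftrightarrow> ?conditions")
proof
  assume ?EL
  interpret jet2_domain "V \<times> Q \<times> T" A
    by standard (intro open_Times assms, rule assms)
  from \<open>?EL\<close> obtain \<Lambda> D where "smooth_on (V \<times> Q \<times> T) \<Lambda>" "smooth_on (V \<times> Q \<times> T) D"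
    "\<And>a. \<forall>acc\<in>A. \<forall>w\<in>V \<times> Q \<times> T.
       f a (acc, w) = total_deriv1 (pv a \<Lambda>) (acc, w) - pq a \<Lambda> w + pv a D w"
    by blast
  from lagrangian_with_dissipation_imp_conditions[OF this] show ?conditions by blast
next
  assume c: ?conditions
  interpret jet_box V Q T "V \<times> Q \<times> T"
    by standard (use assms in auto)
  show ?EL
  \<comment> \<open>If a base point is missing, the domain is empty and the zero functions satisfy
    the equation vacuously.\<close>
  proof (cases "A = {} \<or> V = {} \<or> Q = {}")
    case True
    then show ?thesis
      by (intro exI[of _ "\<lambda>w. 0 :: real"] conjI) auto
  next
    case False
    then obtain a\<^sub>0 v\<^sub>0 q\<^sub>0 where *: "a\<^sub>0 \<in> A" "v\<^sub>0 \<in> V" "q\<^sub>0 \<in> Q" by blast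
    from c show ?thesis
      by (intro conditions_imp_lagrangian_with_dissipation[where f = f, OF assms(1,2) * assms(9)]) blast+
  qed
qed

end
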